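(* Let $G$ be a finitely generated group with the Morse local-to-global property and let $A$ be a finite generating set of $G$. For each Morse gauge $M$, there exists a regular language $L_M\subseteq A^\star$ such that (1) every $M$-Morse geodesic word of $G$ (with respect to $A$) is contained in $L_M$; (2) every element of $L_M$ is an $M'$-Morse geodesic word, where $M'$ is a Morse gauge determined by $M$ (for the given $G$ and $A$). Further, for any choice of total order on the generating set $A$, the short-lex sublanguage of $L_M$ is also regular.
   Context: All finite generating sets are symmetric ($A=A^{-1}$). $A^\star$ is the free monoid on $A$; a language with alphabet $A$ is a subset of $A^\star$; it is regular if it is accepted by a finite state automaton. For $w\in A^\star$, $\overline{w}\in G$ is the element it represents. $\mathrm{Cay}(G,A)$ is the Cayley graph (vertices $g\in G$, $g,h$ joined by an edge labeled $g^{-1}h$ if $g^{-1}h\in A$, edges of length $1$). A word $w\in A^\star$ is a geodesic word if the path in $\mathrm{Cay}(G,A)$ from the identity $e$ to $\overline{w}$ labeled by $w$ is a geodesic; it is an $M$-Morse geodesic word if this geodesic is $M$-Morse. Short-lex sublanguage: given a total order on $A$, extended to a lexicographic order $\preceq$ on $A^\star$, the short-lex sublanguage of $L_M$ is $\{u\in L_M : u\preceq v \text{ for all } v\in L_M \text{ with } \overline{v}=\overline{u}\}$ (words of $L_M$ representing the same element have equal length, being geodesic). Morse quasi-geodesics: let $X$ be a metric space and $I\subseteq\mathbb{R}$ a closed interval. A map $\gamma:I\to X$ is a $(k,c)$-quasi-geodesic ($k\ge1$, $c\ge0$) if $\frac1k|s-t|-c\le d(\gamma(s),\gamma(t))\le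 k|s-t|+c$ for all $s,t\in I$; a geodesic is a $(1,0)$-quasi-geodesic. A Morse gauge is a function $M:[1,\infty)\times[0,\infty)\to[0,\infty)$. A quasi-geodesic $\gamma:I\to X$ is $M$-Morse if for every $[s,t]\subseteq I$, every $(k,c)$-quasi-geodesic with endpoints $\gamma(s),\gamma(t)$ is contained in the $M(k,c)$-neighborhood of $\gamma|_{[s,t]}$. An $(M;k,c)$-Morse quasi-geodesic is an $M$-Morse $(k,c)$-quasi-geodesic. For $B\ge0$, $\gamma:I\to X$ is a $(B;M;k,c)$-local Morse quasi-geodesic if $\gamma|_{[s,t]}$ is an $(M;k,c)$-Morse quasi-geodesic for every $[s,t]\subseteq I$ with $|s-t|\le B$. Morse local-to-global: $X$ is a Morse local-to-global space if for every Morse gauge $M$ and $k\ge1$, $c\ge0$ there exist $B\ge0$, a Morse gauge $M'$, and $k'\ge1$, $c'\ge0$ such that every $(B;M;k,c)$-local Morse quasi-geodesic is an $(M';k',c')$-Morse quasi-geodesic. A finitely generated group has the Morse local-to-global property if some (equivalently, every) Cayley graph of it with respect to a finite generating set is a Morse local-to-global space. *)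

theory Defs
  imports "HOL-Analysis.Analysis" "HOL-Algebra.Generated_Groups"
begin

section \<open>Morse quasi-geodesics and the Morse local-to-global property\<close>

definition quasi_geodesic ::
  "'p metric \<Rightarrow> real \<Rightarrow> real \<Rightarrow> real set \<Rightarrow> (real \<Rightarrow> 'p) \<Rightarrow> bool" where
  "quasi_geodesic X k c I \<gamma> \<longleftrightarrow>
     k \<ge> 1 \<and> c \<ge> 0 \<and> closed I \<and> is_interval I \<and> I \<noteq> {} \<and> \<gamma> ` I \<subseteq> mspace X \<and>
     (\<forall>s\<in>I. \<forall>t\<in>I. 1 / k * \<bar>s - t\<bar> - c \<le> mdist X (\<gamma> s) (\<gamma> t) \<and>
                   mdist X (\<gamma> s) (\<gamma> t) \<le> k * \<bar>s - t\<bar> + c)"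

definition geodesic :: "'p metric \<Rightarrow> real set \<Rightarrow> (real \<Rightarrow> 'p) \<Rightarrow> bool" where
  "geodesic X I \<gamma> \<longleftrightarrow> quasi_geodesic X 1 0 I \<gamma>"

text \<open>Only the values of a gauge at \<open>k \<ge> 1\<close>, \<open>c \<ge> 0\<close> are ever used.\<close>

definition morse_gauge :: "(real \<Rightarrow> real \<Rightarrow> real) \<Rightarrow> bool" where
  "morse_gauge M \<longleftrightarrow> (\<forall>k\<ge>1. \<forall>c\<ge>0. M k c \<ge> 0)"

text \<open>Neighbourhoods are closed, as gauges may take the value \<open>0\<close>. Quasi-geodesics need not be
  continuous.\<close>

definition morse ::
  "'p metric \<Rightarrow> (real \<Rightarrow> real \<Rightarrow> real) \<Rightarrow> real set \<Rightarrow> (real \<Rightarrow> 'p) \<Rightarrow> bool" where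
  "morse X M I \<gamma> \<longleftrightarrow>
     (\<forall>s t. s \<le> t \<and> {s..t} \<subseteq> I \<longrightarrow>
       (\<forall>k\<ge>1. \<forall>c\<ge>0. \<forall>a b \<eta>.
          a \<le> b \<and> quasi_geodesic X k c {a..b} \<eta> \<and> \<eta> a = \<gamma> s \<and> \<eta> b = \<gamma> t \<longrightarrow>
          (\<forall>x\<in>{a..b}. \<exists>y\<in>{s..t}. mdist X (\<eta> x) (\<gamma> y) \<le> M k c)))"

definition morse_quasi_geodesic ::
  "'p metric \<Rightarrow> (real \<Rightarrow> real \<Rightarrow> real) \<Rightarrow> real \<Rightarrow> real \<Rightarrow> real set \<Rightarrow> (real \<Rightarrow> 'p) \<Rightarrow> bool" where
  "morse_quasi_geodesic X M k c I \<gamma> \<longleftrightarrow> quasi_geodesic X k c I \<gamma> \<and> morse X M I \<gamma>"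

definition local_morse_quasi_geodesic ::
  "'p metric \<Rightarrow> real \<Rightarrow> (real \<Rightarrow> real \<Rightarrow> real) \<Rightarrow> real \<Rightarrow> real \<Rightarrow> real set \<Rightarrow> (real \<Rightarrow> 'p) \<Rightarrow> bool" where
  "local_morse_quasi_geodesic X B M k c I \<gamma> \<longleftrightarrow>
     closed I \<and> is_interval I \<and> I \<noteq> {} \<and> \<gamma> ` I \<subseteq> mspace X \<and>
     (\<forall>s t. s \<le> t \<and> {s..t} \<subseteq> I \<and> \<bar>s - t\<bar> \<le> B \<longrightarrow> morse_quasi_geodesic X M k c {s..t} \<gamma>)"

definition morse_local_to_global_space :: "'p metric \<Rightarrow> bool" where
  "morse_local_to_global_space X \<longleftrightarrow>
     (\<forall>M k c. morse_gauge M \<and> k \<ge> 1 \<and> c \<ge> 0 \<longrightarrow>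
       (\<exists>B M' k' c'. B \<ge> 0 \<and> morse_gauge M' \<and> k' \<ge> 1 \<and> c' \<ge> 0 \<and>
          (\<forall>I \<gamma>. local_morse_quasi_geodesic X B M k c I \<gamma> \<longrightarrow>
                 morse_quasi_geodesic X M' k' c' I \<gamma>)))"


section \<open>Cayley graphs as metric graphs\<close>

definition finite_symmetric_generating_set :: "('a, 'b) monoid_scheme \<Rightarrow> 'a set \<Rightarrow> bool" where
  "finite_symmetric_generating_set G A \<longleftrightarrow>
     finite A \<and> A \<subseteq> carrier G \<and> A = (\<lambda>a. inv\<^bsub>G\<^esub> a) ` A \<and> generate G A = carrier G"

definition cayley_edge :: "('a, 'b) monoid_scheme \<Rightarrow> 'a set \<Rightarrow> 'a \<Rightarrow> 'a \<Rightarrow> bool" where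
  "cayley_edge G A g h \<longleftrightarrow> g \<in> carrier G \<and> h \<in> carrier G \<and> inv\<^bsub>G\<^esub> g \<otimes>\<^bsub>G\<^esub> h \<in> A"

text \<open>Points of the geometric realization are given by barycentric coordinates:
  \<open>edge_point g h t\<close> is the point of the edge from \<open>g\<close> to \<open>h\<close> at distance \<open>t\<close> from \<open>g\<close>, and
  \<open>edge_point g g t\<close> is the vertex \<open>g\<close>. So \<open>edge_point g h t = edge_point h g (1 - t)\<close>, and a loop
  (which occurs if \<open>\<one> \<in> A\<close>) collapses to its vertex.\<close>

definition edge_point :: "'a \<Rightarrow> 'a \<Rightarrow> real \<Rightarrow> ('a \<Rightarrow> real)" where
  "edge_point g h t = (\<lambda>x. (1 - t) * indicator {g} x + t * indicator {h} x)"

definition cayley_points :: "('a, 'b) monoid_scheme \<Rightarrow> 'a set \<Rightarrow> ('a \<Rightarrow> real) set" where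
  "cayley_points G A =
     {edge_point g g 0 | g. g \<in> carrier G} \<union>
     {edge_point g h t | g h t. cayley_edge G A g h \<and> t \<in> {0..1}}"

text \<open>\<open>cayley_chain G A p q l\<close>: some piecewise linear path from \<open>p\<close> to \<open>q\<close>, each piece of which runs
  inside one closed edge of length \<open>1\<close>, has length \<open>l\<close>. The distance is the infimum of these lengths.\<close>

inductive cayley_chain ::
  "('a, 'b) monoid_scheme \<Rightarrow> 'a set \<Rightarrow> ('a \<Rightarrow> real) \<Rightarrow> ('a \<Rightarrow> real) \<Rightarrow> real \<Rightarrow> bool"
  for G and A where
  refl: "cayley_chain G A p p 0"
| step: "cayley_edge G A g h \<Longrightarrow> s \<in> {0..1} \<Longrightarrow> t \<in> {0..1} \<Longrightarrow>
    cayley_chain G A (edge_point g h t) q l \<Longrightarrow>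
    cayley_chain G A (edge_point g h s) q (\<bar>s - t\<bar> + l)"

definition cayley_dist ::
  "('a, 'b) monoid_scheme \<Rightarrow> 'a set \<Rightarrow> ('a \<Rightarrow> real) \<Rightarrow> ('a \<Rightarrow> real) \<Rightarrow> real" where
  "cayley_dist G A p q =
     (if p \<in> cayley_points G A \<and> q \<in> cayley_points G A then Inf {l. cayley_chain G A p q l} else 0)"

text \<open>This is meaningful when \<open>A\<close> is a symmetric generating set, by \<open>Metric_space_cayley\<close> below.\<close>

definition cayley_graph :: "('a, 'b) monoid_scheme \<Rightarrow> 'a set \<Rightarrow> ('a \<Rightarrow> real) metric" where
  "cayley_graph G A = metric (cayley_points G A, cayley_dist G A)"

definition morse_local_to_global_group :: "('a, 'b) monoid_scheme \<Rightarrow> bool" where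
  "morse_local_to_global_group G \<longleftrightarrow>
     (\<exists>S. finite_symmetric_generating_set G S \<and> morse_local_to_global_space (cayley_graph G S))"

subsection \<open>The Cayley graph is a metric space\<close>

lemma edge_point_swap: "edge_point g h t = edge_point h g (1 - t)"
  by (auto simp: edge_point_def)

lemma cayley_chain_nonneg: "cayley_chain G A p q l \<Longrightarrow> 0 \<le> l"
  by (induction rule: cayley_chain.induct) auto

lemma cayley_chain_lipschitz: "cayley_chain G A p q l \<Longrightarrow> \<bar>p x - q x\<bar> \<le> l"
proof (induction rule: cayley_chain.induct)
  case (step g h s t q l)
  have "\<bar>edge_point g h s x - edge_point g h t x\<bar> \<le> \<bar>s - t\<bar>"
    by (auto simp: edge_point_def indicator_def)
  with step show ?case by linarith
qed simp

lemma cayley_chain_trans: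
  "cayley_chain G A p q l \<Longrightarrow> cayley_chain G A q r m \<Longrightarrow> cayley_chain G A p r (l + m)"
proof (induction rule: cayley_chain.induct)
  case (step g h s t q l)
  then show ?case
    using cayley_chain.step[of G A g h s t r "l + m"] by (simp add: add.assoc)
qed simp

lemma cayley_chain_edge:
  "cayley_edge G A g h \<Longrightarrow> s \<in> {0..1} \<Longrightarrow> t \<in> {0..1} \<Longrightarrow>
   cayley_chain G A (edge_point g h s) (edge_point g h t) \<bar>s - t\<bar>"
  using cayley_chain.step[OF _ _ _ cayley_chain.refl] by fastforce

lemma cayley_chain_sym: "cayley_chain G A p q l \<Longrightarrow> cayley_chain G A q p l"
proof (induction rule: cayley_chain.induct)
  case (step g h s t q l)
  then show ?case
    using cayley_chain_trans[OF step(5) cayley_chain_edge[OF step(1,3,2)]]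
    by (simp add: abs_minus_commute add.commute)
qed (rule cayley_chain.refl)

lemma cayley_chain_from_one:
  assumes "group G" "finite_symmetric_generating_set G A" "g \<in> carrier G"
  shows "\<exists>l. cayley_chain G A (edge_point \<one>\<^bsub>G\<^esub> \<one>\<^bsub>G\<^esub> 0) (edge_point g g 0) l"
proof -
  interpret group G by fact
  have A: "A \<subseteq> carrier G" "A = (\<lambda>a. inv\<^bsub>G\<^esub> a) ` A" "generate G A = carrier G"
    using assms(2) by (auto simp: finite_symmetric_generating_set_def)
  have gen: "g \<in> generate G A" using assms(3) A by simp
  have edge: "\<exists>l. cayley_chain G A (edge_point k k 0) (edge_point (k \<otimes>\<^bsub>G\<^esub> a) (k \<otimes>\<^bsub>G\<^esub> a) 0) l"
    if "k \<in> carrier G" "a \<in> A" for k a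
  proof -
    have "inv\<^bsub>G\<^esub> k \<otimes>\<^bsub>G\<^esub> (k \<otimes>\<^bsub>G\<^esub> a) = a"
      using that A(1) by (simp add: m_assoc[symmetric] subset_iff)
    then have "cayley_edge G A k (k \<otimes>\<^bsub>G\<^esub> a)"
      using that A(1) by (auto simp: cayley_edge_def)
    from cayley_chain_edge[OF this, of 0 1] show ?thesis
      by (auto simp: edge_point_def)
  qed
  have "\<exists>l. cayley_chain G A (edge_point k k 0) (edge_point (k \<otimes>\<^bsub>G\<^esub> g) (k \<otimes>\<^bsub>G\<^esub> g) 0) l"
    if "k \<in> carrier G" for k
    using gen that
  proof (induction arbitrary: k rule: generate.induct)
    case one
    then show ?case using cayley_chain.refl by auto
  next
    case (incl h)
    then show ?case using edge by blast
  next
    case (inv h)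
    moreover have "inv\<^bsub>G\<^esub> h \<in> A" using A(2) inv(1) by blast
    ultimately show ?case using edge by blast
  next
    case (eng h1 h2)
    have c: "h1 \<in> carrier G" "h2 \<in> carrier G"
      using eng(1,2) A(3) by auto
    obtain l where l: "cayley_chain G A (edge_point k k 0) (edge_point (k \<otimes>\<^bsub>G\<^esub> h1) (k \<otimes>\<^bsub>G\<^esub> h1) 0) l"
      using eng by blast
    obtain m where m: "cayley_chain G A (edge_point (k \<otimes>\<^bsub>G\<^esub> h1) (k \<otimes>\<^bsub>G\<^esub> h1) 0)
        (edge_point (k \<otimes>\<^bsub>G\<^esub> h1 \<otimes>\<^bsub>G\<^esub> h2) (k \<otimes>\<^bsub>G\<^esub> h1 \<otimes>\<^bsub>G\<^esub> h2) 0) m"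
      using eng(4)[of "k \<otimes>\<^bsub>G\<^esub> h1"] eng(5) c by auto
    show ?case
      using cayley_chain_trans[OF l m] eng(5) c by (auto simp: m_assoc)
  qed
  from this[of "\<one>\<^bsub>G\<^esub>"] assms(3) show ?thesis by simp
qed

lemma cayley_chain_exists:
  assumes "group G" "finite_symmetric_generating_set G A"
    and "p \<in> cayley_points G A" "q \<in> cayley_points G A"
  shows "\<exists>l. cayley_chain G A p q l"
proof -
  have *: "\<exists>l. cayley_chain G A (edge_point \<one>\<^bsub>G\<^esub> \<one>\<^bsub>G\<^esub> 0) p l" if "p \<in> cayley_points G A" for p
    using that unfolding cayley_points_def
  proof (elim UnE)
    assume "p \<in> {edge_point g g 0 | g. g \<in> carrier G}"
    then show ?thesis using cayley_chain_from_one[OF assms(1,2)] by blast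
  next
    assume "p \<in> {edge_point g h t | g h t. cayley_edge G A g h \<and> t \<in> {0..1}}"
    then obtain g h t where p: "p = edge_point g h t" and e: "cayley_edge G A g h" and t: "t \<in> {0..1}"
      by blast
    obtain l where l: "cayley_chain G A (edge_point \<one>\<^bsub>G\<^esub> \<one>\<^bsub>G\<^esub> 0) (edge_point g g 0) l"
      using cayley_chain_from_one[OF assms(1,2)] e by (auto simp: cayley_edge_def)
    have "edge_point g g 0 = edge_point g h 0"
      by (auto simp: edge_point_def)
    then have "cayley_chain G A (edge_point g g 0) p \<bar>0 - t\<bar>"
      using cayley_chain_edge[OF e, of 0 t] t p by auto
    then show ?thesis using cayley_chain_trans[OF l] by blast
  qed
  from *[OF assms(3)] *[OF assms(4)] show ?thesis
    by (meson cayley_chain_sym cayley_chain_trans)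
qed

lemma Metric_space_cayley:
  assumes "group G" "finite_symmetric_generating_set G A"
  shows "Metric_space (cayley_points G A) (cayley_dist G A)"
proof -
  have bdd: "bdd_below {l. cayley_chain G A p q l}" for p q
    using cayley_chain_nonneg by (intro bdd_belowI[of _ 0]) auto
  have ne: "{l. cayley_chain G A p q l} \<noteq> {}"
    if "p \<in> cayley_points G A" "q \<in> cayley_points G A" for p q
    using cayley_chain_exists[OF assms that] by auto
  have nonneg: "0 \<le> cayley_dist G A p q" for p q
    unfolding cayley_dist_def by (auto intro!: cInf_greatest[OF ne] dest: cayley_chain_nonneg)
  show ?thesis
  proof
    fix p q
    show "0 \<le> cayley_dist G A p q" by (rule nonneg)
    have "{l. cayley_chain G A p q l} = {l. cayley_chain G A q p l}"
      using cayley_chain_sym by blast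
    then show "cayley_dist G A p q = cayley_dist G A q p"
      by (simp add: cayley_dist_def)
  next
    fix p q assume pq: "p \<in> cayley_points G A" "q \<in> cayley_points G A"
    have "\<bar>p x - q x\<bar> \<le> cayley_dist G A p q" for x
    proof -
      have "\<bar>p x - q x\<bar> \<le> Inf {l. cayley_chain G A p q l}"
        by (intro cInf_greatest[OF ne[OF pq]]) (auto intro: cayley_chain_lipschitz)
      then show ?thesis using pq by (simp add: cayley_dist_def)
    qed
    moreover have "cayley_dist G A p p \<le> 0"
      using cInf_lower[OF _ bdd, of 0 p p] pq cayley_chain.refl[of G A p]
      by (auto simp: cayley_dist_def)
    ultimately show "cayley_dist G A p q = 0 \<longleftrightarrow> p = q"
      using nonneg[of p p] by (metis abs_le_zero_iff eq_iff_diff_eq_0 ext order_antisym)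
  next
    fix p q r
    assume pqr: "p \<in> cayley_points G A" "q \<in> cayley_points G A" "r \<in> cayley_points G A"
    have "cayley_dist G A p r \<le> l + m" if "cayley_chain G A p q l" "cayley_chain G A q r m" for l m
      using cInf_lower[OF _ bdd, of "l + m" p r] cayley_chain_trans[OF that] pqr
      by (auto simp: cayley_dist_def)
    then have "cayley_dist G A p r - m \<le> l" if "cayley_chain G A p q l" "cayley_chain G A q r m" for l m
      using that by (simp add: diff_le_eq)
    then have "cayley_dist G A p r - m \<le> Inf {l. cayley_chain G A p q l}"
      if "cayley_chain G A q r m" for m
      using that by (intro cInf_greatest[OF ne[OF pqr(1,2)]]) auto
    then have "cayley_dist G A p r - m \<le> cayley_dist G A p q" if "cayley_chain G A q r m" for m
      using that pqr(1,2) by (simp add: cayley_dist_def[of G A p q])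
    then have "cayley_dist G A p r - cayley_dist G A p q \<le> Inf {l. cayley_chain G A q r l}"
      by (intro cInf_greatest[OF ne[OF pqr(2,3)]]) (auto simp: algebra_simps)
    then have "cayley_dist G A p r - cayley_dist G A p q \<le> cayley_dist G A q r"
      using pqr(2,3) by (simp add: cayley_dist_def[of G A q r])
    then show "cayley_dist G A p r \<le> cayley_dist G A p q + cayley_dist G A q r"
      by simp
  qed
qed

lemma
  assumes "group G" "finite_symmetric_generating_set G A"
  shows mspace_cayley_graph: "mspace (cayley_graph G A) = cayley_points G A"
    and mdist_cayley_graph: "mdist (cayley_graph G A) = cayley_dist G A"
  using Metric_space.mspace_metric[OF Metric_space_cayley[OF assms]]
    Metric_space.mdist_metric[OF Metric_space_cayley[OF assms]]
  by (simp_all add: cayley_graph_def)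


section \<open>Words and languages\<close>

definition word_val :: "('a, 'b) monoid_scheme \<Rightarrow> 'a list \<Rightarrow> 'a" where
  "word_val G w = foldr (\<otimes>\<^bsub>G\<^esub>) w \<one>\<^bsub>G\<^esub>"

text \<open>The path labelled by \<open>w\<close> starting at the identity, parametrized by \<open>[0, length w]\<close>.\<close>

definition word_path :: "('a, 'b) monoid_scheme \<Rightarrow> 'a list \<Rightarrow> real \<Rightarrow> ('a \<Rightarrow> real)" where
  "word_path G w x =
     (let i = nat \<lfloor>x\<rfloor>
      in edge_point (word_val G (take i w)) (word_val G (take (Suc i) w)) (x - real i))"

definition geodesic_word :: "('a, 'b) monoid_scheme \<Rightarrow> 'a set \<Rightarrow> 'a list \<Rightarrow> bool" where
  "geodesic_word G A w \<longleftrightarrow>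
     w \<in> lists A \<and> geodesic (cayley_graph G A) {0..real (length w)} (word_path G w)"

definition morse_geodesic_word ::
  "('a, 'b) monoid_scheme \<Rightarrow> 'a set \<Rightarrow> (real \<Rightarrow> real \<Rightarrow> real) \<Rightarrow> 'a list \<Rightarrow> bool" where
  "morse_geodesic_word G A M w \<longleftrightarrow>
     geodesic_word G A w \<and> morse (cayley_graph G A) M {0..real (length w)} (word_path G w)"

text \<open>Acceptance by a deterministic finite automaton over \<open>A\<close>; up to renaming, its states are natural
  numbers.\<close>

definition regular_language :: "'a set \<Rightarrow> 'a list set \<Rightarrow> bool" where
  "regular_language A L \<longleftrightarrow>
     (\<exists>(Q :: nat set) q0 F \<delta>.
        finite Q \<and> q0 \<in> Q \<and> F \<subseteq> Q \<and> (\<forall>q\<in>Q. \<forall>a\<in>A. \<delta> q a \<in> Q) \<and>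
        L = {w \<in> lists A. foldl \<delta> q0 w \<in> F})"

definition lex_le :: "('a \<times> 'a) set \<Rightarrow> 'a list \<Rightarrow> 'a list \<Rightarrow> bool" where
  "lex_le r u v \<longleftrightarrow> u = v \<or> (u, v) \<in> lexord (r - Id)"

definition short_lex :: "('a, 'b) monoid_scheme \<Rightarrow> ('a \<times> 'a) set \<Rightarrow> 'a list set \<Rightarrow> 'a list set" where
  "short_lex G r L = {u \<in> L. \<forall>v\<in>L. word_val G v = word_val G u \<longrightarrow> lex_le r u v}"

end

theory Submission
  imports Defs
begin

text \<open>The proof describes the words in question by conditions that a finite automaton can check.

  Write \<open>X\<close> for the Cayley graph of \<open>G\<close> with respect to \<open>A\<close>. The hypothesis concerns the Cayley graph of
  some other finite generating set. It passes to \<open>X\<close> because the two graphs are quasi-isometric and the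
  Morse local-to-global property is a quasi-isometry invariant
  (\<open>morse_local_to_global_coarse_equivalence\<close>, \<open>coarse_equivalence_generating_sets\<close>).

  Given \<open>M\<close>, let \<open>B\<close> and \<open>M'\<close> be the scale and the gauge that this property provides for local
  \<open>M\<close>-Morse geodesics in \<open>X\<close>. Let \<open>L\<close> consist of the geodesic words all of whose infixes of length at
  most \<open>\<lceil>B\<rceil> + 1\<close> are \<open>M\<close>-Morse geodesic words. Infixes of \<open>M\<close>-Morse geodesic words are
  \<open>M\<close>-Morse, since left translations are isometries, so \<open>L\<close> contains all \<open>M\<close>-Morse geodesic words.
  Conversely the path of a word with such infixes is a local Morse geodesic, hence \<open>M'\<close>-Morse
  (\<open>local_morse_word_path\<close>).

  The condition on infixes is locally testable, hence regular. The main point is that geodesicity is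
  regular among the words that satisfy it. If such a word is not geodesic, then the shortest
  non-geodesic prefix is a geodesic followed by one letter. Its path is \<open>M'\<close>-Morse, so a geodesic with
  the same end follows it at bounded distance, and synchronously, because both leave the identity
  at almost unit speed (\<open>geodesic_fellow_travels\<close>). This geodesic is shorter and can afford to wait.
  Hence the word has a companion that waits at least once, stays within a bounded distance, and has the
  same end (\<open>detour_if_not_geodesic\<close>). Conversely, a word with a waiting companion is not geodesic. The
  difference between a word and its companion takes finitely many values, so pairs of fellow
  travelling words form a regular language, and the words that have a waiting companion are the
  projection of a regular language.

  The short-lex language is treated in the same way: two words of \<open>L\<close> with the same end have the same
  length and fellow travel, so the words of \<open>L\<close> that are not least are again the projection of a regular
  language of pairs (\<open>regular_short_lex\<close>).\<close>

section \<open>Coarse equivalences and the Morse property\<close>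

text \<open>A pair of mutually quasi-inverse quasi-isometries. One constant serves all estimates, so that
  the notion is symmetric in the two spaces.\<close>

definition coarse_equivalence ::
  "real \<Rightarrow> 'p metric \<Rightarrow> 'q metric \<Rightarrow> ('p \<Rightarrow> 'q) \<Rightarrow> ('q \<Rightarrow> 'p) \<Rightarrow> bool" where
  "coarse_equivalence K X Y \<phi> \<psi> \<longleftrightarrow>
     K \<ge> 1 \<and> \<phi> \<in> mspace X \<rightarrow> mspace Y \<and> \<psi> \<in> mspace Y \<rightarrow> mspace X \<and>
     (\<forall>p\<in>mspace X. \<forall>q\<in>mspace X. mdist Y (\<phi> p) (\<phi> q) \<le> K * mdist X p q + K) \<and>
     (\<forall>p\<in>mspace Y. \<forall>q\<in>mspace Y. mdist X (\<psi> p) (\<psi> q) \<le> K * mdist Y p q + K) \<and>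
     (\<forall>p\<in>mspace X. mdist X (\<psi> (\<phi> p)) p \<le> K) \<and>
     (\<forall>q\<in>mspace Y. mdist Y (\<phi> (\<psi> q)) q \<le> K)"

lemma coarse_equivalence_sym:
  "coarse_equivalence K X Y \<phi> \<psi> \<Longrightarrow> coarse_equivalence K Y X \<psi> \<phi>"
  unfolding coarse_equivalence_def by auto

lemma mdist_self: "p \<in> mspace X \<Longrightarrow> mdist X p p = 0"
  by simp

lemma mdist_triangle3:
  assumes "p \<in> mspace X" "q \<in> mspace X" "r \<in> mspace X" "s \<in> mspace X"
  shows "mdist X p s \<le> mdist X p q + mdist X q r + mdist X r s"
  using mdist_triangle[OF assms(1,2,4)] mdist_triangle[OF assms(2,3,4)] by linarith

text \<open>The path in \<open>Y\<close> only has to follow \<open>\<phi> \<circ> \<gamma>\<close> up to a bounded error; this freedom is used to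
  correct the endpoints of a transported quasi-geodesic.\<close>

lemma quasi_geodesic_coarse_image:
  assumes ce: "coarse_equivalence K X Y \<phi> \<psi>"
    and qg: "quasi_geodesic X k c I \<gamma>"
    and close: "\<And>t. t \<in> I \<Longrightarrow> \<gamma>' t \<in> mspace Y \<and> mdist Y (\<gamma>' t) (\<phi> (\<gamma> t)) \<le> E"
  shows "quasi_geodesic Y (K * k) (K * c + 3 * K + 2 * E) I \<gamma>'"
proof -
  have K: "K \<ge> 1" and k: "k \<ge> 1" and c: "c \<ge> 0" and I: "closed I" "is_interval I" "I \<noteq> {}"
    using ce qg by (auto simp only: coarse_equivalence_def quasi_geodesic_def)
  have \<gamma>: "\<gamma> t \<in> mspace X" if "t \<in> I" for t
    using qg that unfolding quasi_geodesic_def by blast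
  obtain t0 where "t0 \<in> I" using \<open>I \<noteq> {}\<close> by blast
  have E: "E \<ge> 0" using close[OF \<open>t0 \<in> I\<close>] mdist_nonneg[of Y "\<gamma>' t0" "\<phi> (\<gamma> t0)"] by linarith
  have *: "1 / (K * k) * \<bar>s - t\<bar> - (K * c + 3 * K + 2 * E) \<le> mdist Y (\<gamma>' s) (\<gamma>' t) \<and>
        mdist Y (\<gamma>' s) (\<gamma>' t) \<le> K * k * \<bar>s - t\<bar> + (K * c + 3 * K + 2 * E)"
    if st: "s \<in> I" "t \<in> I" for s t
  proof -
    let ?x = "\<gamma> s" and ?y = "\<gamma> t"
    have x: "?x \<in> mspace X" "?y \<in> mspace X" using \<gamma> st by auto
    have px: "\<phi> ?x \<in> mspace Y" "\<phi> ?y \<in> mspace Y"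
      "\<psi> (\<phi> ?x) \<in> mspace X" "\<psi> (\<phi> ?y) \<in> mspace X"
      using ce x unfolding coarse_equivalence_def by auto
    have g': "\<gamma>' s \<in> mspace Y" "\<gamma>' t \<in> mspace Y" using close st by auto
    have e: "mdist Y (\<gamma>' s) (\<phi> ?x) \<le> E" "mdist Y (\<gamma>' t) (\<phi> ?y) \<le> E" using close st by auto
    have lo: "1 / k * \<bar>s - t\<bar> - c \<le> mdist X ?x ?y" and hi: "mdist X ?x ?y \<le> k * \<bar>s - t\<bar> + c"
      using qg st unfolding quasi_geodesic_def by auto
    have "mdist Y (\<phi> ?x) (\<phi> ?y) \<le> K * mdist X ?x ?y + K"
      using ce x unfolding coarse_equivalence_def by auto
    also have "\<dots> \<le> K * (k * \<bar>s - t\<bar> + c) + K"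
      using hi K by (simp add: mult_left_mono)
    finally have up: "mdist Y (\<phi> ?x) (\<phi> ?y) \<le> K * k * \<bar>s - t\<bar> + K * c + K"
      by (simp add: algebra_simps)
    have "mdist X ?x ?y \<le> mdist X ?x (\<psi> (\<phi> ?x)) + mdist X (\<psi> (\<phi> ?x)) (\<psi> (\<phi> ?y)) + mdist X (\<psi> (\<phi> ?y)) ?y"
      by (rule mdist_triangle3) (use x px in auto)
    also have "\<dots> \<le> K + (K * mdist Y (\<phi> ?x) (\<phi> ?y) + K) + K"
      using ce x px unfolding coarse_equivalence_def by (intro add_mono) (auto simp: mdist_commute)
    finally have "1 / k * \<bar>s - t\<bar> - c \<le> K * (mdist Y (\<phi> ?x) (\<phi> ?y) + 3)"
      using lo by (simp add: algebra_simps)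
    then have "(1 / k * \<bar>s - t\<bar> - c) / K \<le> mdist Y (\<phi> ?x) (\<phi> ?y) + 3"
      using K by (simp add: divide_le_eq mult.commute)
    moreover have "(1 / k * \<bar>s - t\<bar> - c) / K = 1 / (K * k) * \<bar>s - t\<bar> - c / K"
      by (simp add: diff_divide_distrib mult.commute)
    moreover have "c / K \<le> K * c"
    proof -
      have "c / K \<le> c" using K c by (simp add: divide_le_eq mult_le_cancel_left1)
      also have "c \<le> K * c" using K c by (simp add: mult_le_cancel_right1)
      finally show ?thesis .
    qed
    ultimately have low: "1 / (K * k) * \<bar>s - t\<bar> - (K * c + 3 * K) \<le> mdist Y (\<phi> ?x) (\<phi> ?y)"
      using K by linarith
    have "mdist Y (\<gamma>' s) (\<gamma>' t) \<le> mdist Y (\<gamma>' s) (\<phi> ?x) + mdist Y (\<phi> ?x) (\<phi> ?y) + mdist Y (\<phi> ?y) (\<gamma>' t)"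
      by (rule mdist_triangle3) (use g' px in auto)
    moreover have "mdist Y (\<phi> ?x) (\<phi> ?y) \<le> mdist Y (\<phi> ?x) (\<gamma>' s) + mdist Y (\<gamma>' s) (\<gamma>' t) + mdist Y (\<gamma>' t) (\<phi> ?y)"
      by (rule mdist_triangle3) (use g' px in auto)
    ultimately show ?thesis
      using e up low K by (simp add: mdist_commute)
  qed
  have "1 \<le> K * k" using K k by (metis mult_mono mult_1 zero_le_one order_trans)
  moreover have "0 \<le> K * c + 3 * K + 2 * E" using K c E by simp
  ultimately show ?thesis
    unfolding quasi_geodesic_def using I * close by blast
qed

text \<open>The gauge inherited by a path that stays within \<open>E\<close> of the image of an \<open>M\<close>-Morse path. The term
  \<open>2 * K + K * E\<close> bounds how far the ends of a competitor are moved in the proof below.\<close>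

definition coarse_gauge :: "real \<Rightarrow> real \<Rightarrow> (real \<Rightarrow> real \<Rightarrow> real) \<Rightarrow> real \<Rightarrow> real \<Rightarrow> real" where
  "coarse_gauge K E M k c =
     K * M (K * k) (K * c + 3 * K + 2 * (2 * K + K * E)) + 2 * K + E"

lemma morse_gauge_coarse_gauge:
  assumes "morse_gauge M" "K \<ge> 1" "E \<ge> 0"
  shows "morse_gauge (coarse_gauge K E M)"
proof -
  have "1 \<le> K * k" if "k \<ge> 1" for k
    using that assms(2) by (metis mult_mono mult_1 zero_le_one order_trans)
  then show ?thesis
    using assms by (auto simp: morse_gauge_def coarse_gauge_def)
qed

text \<open>A competitor \<open>\<eta>\<close> in \<open>Y\<close> is carried back to \<open>X\<close> by \<open>\<psi>\<close>. Its ends are then near \<open>\<gamma>\<close> but not on it.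
  Since quasi-geodesics need not be continuous, the two end values may simply be replaced by points of
  \<open>\<gamma>\<close>, at the price of a larger additive constant; the Morse property of \<open>\<gamma>\<close> then applies.\<close>

lemma morse_coarse_image:
  assumes ce: "coarse_equivalence K X Y \<phi> \<psi>" and E: "E \<ge> 0"
    and M: "morse_gauge M" and morse: "morse X M I \<gamma>"
    and \<gamma>: "\<And>t. t \<in> I \<Longrightarrow> \<gamma> t \<in> mspace X"
    and close: "\<And>t. t \<in> I \<Longrightarrow> \<gamma>' t \<in> mspace Y \<and> mdist Y (\<gamma>' t) (\<phi> (\<gamma> t)) \<le> E"
  shows "morse Y (coarse_gauge K E M) I \<gamma>'"
  unfolding morse_def
proof (intro allI impI ballI, elim conjE)
  fix s t k c a b :: real and \<eta> x
  assume st: "s \<le> t" "{s..t} \<subseteq> I" and k: "1 \<le> k" and c: "0 \<le> c" and ab: "a \<le> b"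
    and qg: "quasi_geodesic Y k c {a..b} \<eta>" and ends: "\<eta> a = \<gamma>' s" "\<eta> b = \<gamma>' t" and x: "x \<in> {a..b}"
  have K: "K \<ge> 1" using ce unfolding coarse_equivalence_def by auto
  have sI: "s \<in> I" "t \<in> I" using st by auto
  have gauge: "coarse_gauge K E M k c \<ge> 0"
    using morse_gauge_coarse_gauge[OF M K E] k c unfolding morse_gauge_def by blast
  show "\<exists>y\<in>{s..t}. mdist Y (\<eta> x) (\<gamma>' y) \<le> coarse_gauge K E M k c"
  proof (cases "x = a \<or> x = b")
    case True
    then have "\<eta> x = \<gamma>' s \<or> \<eta> x = \<gamma>' t" using ends by auto
    moreover have "mdist Y (\<gamma>' y) (\<gamma>' y) = 0" if "y \<in> {s, t}" for y
      using close[of y] that sI by auto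
    ultimately show ?thesis using gauge st(1) by (metis atLeastAtMost_iff insertI1 insertI2 order_refl)
  next
    case False
    define \<eta>' where "\<eta>' u = (if u = a then \<gamma> s else if u = b then \<gamma> t else \<psi> (\<eta> u))" for u
    let ?k = "K * k" and ?c = "K * c + 3 * K + 2 * (2 * K + K * E)"
    have \<eta>: "\<eta> u \<in> mspace Y" if "u \<in> {a..b}" for u
      using qg that unfolding quasi_geodesic_def by blast
    have endclose: "mdist X (\<gamma> r) (\<psi> (\<gamma>' r)) \<le> 2 * K + K * E" if r: "r \<in> I" for r
    proof -
      have m: "\<gamma> r \<in> mspace X" "\<phi> (\<gamma> r) \<in> mspace Y" "\<psi> (\<phi> (\<gamma> r)) \<in> mspace X"
        "\<gamma>' r \<in> mspace Y" "\<psi> (\<gamma>' r) \<in> mspace X"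
        using ce \<gamma>[OF r] close[OF r] unfolding coarse_equivalence_def by auto
      have "mdist X (\<gamma> r) (\<psi> (\<gamma>' r)) \<le> mdist X (\<gamma> r) (\<psi> (\<phi> (\<gamma> r))) + mdist X (\<psi> (\<phi> (\<gamma> r))) (\<psi> (\<gamma>' r))"
        using m by (intro mdist_triangle)
      moreover have "mdist X (\<gamma> r) (\<psi> (\<phi> (\<gamma> r))) \<le> K"
        using ce m unfolding coarse_equivalence_def by (auto simp: mdist_commute)
      moreover have "mdist X (\<psi> (\<phi> (\<gamma> r))) (\<psi> (\<gamma>' r)) \<le> K * mdist Y (\<phi> (\<gamma> r)) (\<gamma>' r) + K"
        using ce m unfolding coarse_equivalence_def by auto
      moreover have "K * mdist Y (\<phi> (\<gamma> r)) (\<gamma>' r) \<le> K * E"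
        using close[OF r] K by (simp add: mdist_commute mult_left_mono)
      ultimately show ?thesis by linarith
    qed
    have "quasi_geodesic X ?k ?c {a..b} \<eta>'"
    proof (rule quasi_geodesic_coarse_image)
      show "coarse_equivalence K Y X \<psi> \<phi>" using ce by (rule coarse_equivalence_sym)
      show "quasi_geodesic Y k c {a..b} \<eta>" by (rule qg)
      fix u assume u: "u \<in> {a..b}"
      then have "\<psi> (\<eta> u) \<in> mspace X" using \<eta>[OF u] ce unfolding coarse_equivalence_def by auto
      moreover have "0 \<le> 2 * K + K * E" using K E by simp
      ultimately show "\<eta>' u \<in> mspace X \<and> mdist X (\<eta>' u) (\<psi> (\<eta> u)) \<le> 2 * K + K * E"
        using endclose sI \<gamma> ends by (auto simp: \<eta>'_def mdist_self)
    qed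
    moreover have "1 \<le> ?k" "0 \<le> ?c"
      using K k c E by (auto simp: mult_ge1_I)
    moreover have "\<eta>' a = \<gamma> s" "\<eta>' b = \<gamma> t"
      using False x by (auto simp: \<eta>'_def)
    ultimately obtain y where y: "y \<in> {s..t}" "mdist X (\<eta>' x) (\<gamma> y) \<le> M ?k ?c"
      using morse st ab x unfolding morse_def by blast
    have yI: "y \<in> I" using y st by auto
    have m: "\<eta> x \<in> mspace Y" "\<psi> (\<eta> x) \<in> mspace X" "\<phi> (\<psi> (\<eta> x)) \<in> mspace Y"
      "\<gamma> y \<in> mspace X" "\<phi> (\<gamma> y) \<in> mspace Y" "\<gamma>' y \<in> mspace Y"
      using ce \<eta>[OF x] \<gamma>[OF yI] close[OF yI] unfolding coarse_equivalence_def by auto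
    have "mdist Y (\<eta> x) (\<gamma>' y)
        \<le> mdist Y (\<eta> x) (\<phi> (\<psi> (\<eta> x))) + mdist Y (\<phi> (\<psi> (\<eta> x))) (\<phi> (\<gamma> y)) + mdist Y (\<phi> (\<gamma> y)) (\<gamma>' y)"
      using m by (intro mdist_triangle3)
    moreover have "mdist Y (\<eta> x) (\<phi> (\<psi> (\<eta> x))) \<le> K"
      using ce m unfolding coarse_equivalence_def by (auto simp: mdist_commute)
    moreover have "mdist Y (\<phi> (\<psi> (\<eta> x))) (\<phi> (\<gamma> y)) \<le> K * mdist X (\<psi> (\<eta> x)) (\<gamma> y) + K"
      using ce m unfolding coarse_equivalence_def by auto
    moreover have "K * mdist X (\<psi> (\<eta> x)) (\<gamma> y) \<le> K * M ?k ?c"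
      using y(2) False K by (simp add: \<eta>'_def mult_left_mono)
    moreover have "mdist Y (\<phi> (\<gamma> y)) (\<gamma>' y) \<le> E"
      using close[OF yI] by (simp add: mdist_commute)
    ultimately show ?thesis
      using y(1) unfolding coarse_gauge_def by (intro bexI[of _ y]) linarith+
  qed
qed

text \<open>Local Morse quasi-geodesics of \<open>Y\<close> are carried to \<open>X\<close>, globalized there and carried back; the return
  trip ends at distance at most \<open>K\<close> from the original path.\<close>

theorem morse_local_to_global_coarse_equivalence:
  assumes mltg: "morse_local_to_global_space X" and ce: "coarse_equivalence K X Y \<phi> \<psi>"
  shows "morse_local_to_global_space Y"
  unfolding morse_local_to_global_space_def
proof (intro allI impI, elim conjE)
  fix M and k c :: real
  assume M: "morse_gauge M" and k: "k \<ge> 1" and c: "c \<ge> 0"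
  have ce': "coarse_equivalence K Y X \<psi> \<phi>" using ce by (rule coarse_equivalence_sym)
  have K: "K \<ge> 1" using ce unfolding coarse_equivalence_def by auto
  let ?N = "coarse_gauge K 0 M" and ?k1 = "K * k" and ?c1 = "K * c + 3 * K + 2 * 0"
  have "morse_gauge ?N" "?k1 \<ge> 1" "?c1 \<ge> 0"
    using morse_gauge_coarse_gauge[OF M K] K k c by (auto simp: mult_ge1_I)
  then obtain B N' k' c' where B: "B \<ge> 0" and N': "morse_gauge N'" and k': "k' \<ge> 1" and c': "c' \<ge> 0"
    and global: "\<And>I \<gamma>. local_morse_quasi_geodesic X B ?N ?k1 ?c1 I \<gamma> \<Longrightarrow> morse_quasi_geodesic X N' k' c' I \<gamma>"
    using mltg unfolding morse_local_to_global_space_def by blast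
  let ?M' = "coarse_gauge K K N'" and ?k2 = "K * k'" and ?c2 = "K * c' + 3 * K + 2 * K"
  have "morse_quasi_geodesic Y ?M' ?k2 ?c2 I \<gamma>"
    if loc: "local_morse_quasi_geodesic Y B M k c I \<gamma>" for I \<gamma>
  proof -
    have \<gamma>: "\<gamma> t \<in> mspace Y" "\<psi> (\<gamma> t) \<in> mspace X" "mdist Y (\<gamma> t) (\<phi> (\<psi> (\<gamma> t))) \<le> K" if "t \<in> I" for t
      using loc that ce unfolding local_morse_quasi_geodesic_def coarse_equivalence_def
      by (auto simp: mdist_commute image_subset_iff)
    have "local_morse_quasi_geodesic X B ?N ?k1 ?c1 I (\<psi> \<circ> \<gamma>)"
      unfolding local_morse_quasi_geodesic_def
    proof (intro conjI allI impI; (elim conjE)?)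
      fix s t assume st: "s \<le> t" "{s..t} \<subseteq> I" "\<bar>s - t\<bar> \<le> B"
      then have piece: "quasi_geodesic Y k c {s..t} \<gamma>" "morse Y M {s..t} \<gamma>"
        using loc unfolding local_morse_quasi_geodesic_def morse_quasi_geodesic_def by auto
      have close: "(\<psi> \<circ> \<gamma>) u \<in> mspace X \<and> mdist X ((\<psi> \<circ> \<gamma>) u) (\<psi> (\<gamma> u)) \<le> 0" if "u \<in> {s..t}" for u
        using \<gamma>(2)[of u] that st(2) by (auto simp: mdist_self)
      show "morse_quasi_geodesic X ?N ?k1 ?c1 {s..t} (\<psi> \<circ> \<gamma>)"
        unfolding morse_quasi_geodesic_def
        using quasi_geodesic_coarse_image[OF ce' piece(1) close]
          morse_coarse_image[OF ce' _ M piece(2) _ close] \<gamma> st(2) by fastforce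
    qed (use loc \<gamma> in \<open>auto simp: local_morse_quasi_geodesic_def\<close>)
    from global[OF this] have g: "quasi_geodesic X k' c' I (\<psi> \<circ> \<gamma>)" "morse X N' I (\<psi> \<circ> \<gamma>)"
      unfolding morse_quasi_geodesic_def by auto
    show ?thesis
      unfolding morse_quasi_geodesic_def
      using quasi_geodesic_coarse_image[OF ce g(1), of \<gamma> K]
        morse_coarse_image[OF ce _ N' g(2), of K \<gamma>] \<gamma> K by auto
  qed
  moreover have "morse_gauge ?M'" "?k2 \<ge> 1" "?c2 \<ge> 0"
    using morse_gauge_coarse_gauge[OF N' K] K k' c' by (auto simp: mult_ge1_I)
  ultimately show "\<exists>B M' k' c'. B \<ge> 0 \<and> morse_gauge M' \<and> k' \<ge> 1 \<and> c' \<ge> 0 \<and>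
      (\<forall>I \<gamma>. local_morse_quasi_geodesic Y B M k c I \<gamma> \<longrightarrow> morse_quasi_geodesic Y M' k' c' I \<gamma>)"
    using B by blast
qed

section \<open>The geometry of Cayley graphs\<close>

text \<open>An isometry preserves the Morse gauge exactly. The shift of the parameter by \<open>d\<close> is there because a
  subpath of a word path is read off from a word path that starts at time \<open>0\<close>.\<close>

lemma morse_isometry:
  assumes morse: "morse X M I \<gamma>"
    and T: "T \<in> mspace X \<rightarrow> mspace X" "T' \<in> mspace X \<rightarrow> mspace X"
    and inverse: "\<And>p. p \<in> mspace X \<Longrightarrow> T (T' p) = p" "\<And>p. p \<in> mspace X \<Longrightarrow> T' (T p) = p"
    and isometry: "\<And>p q. p \<in> mspace X \<Longrightarrow> q \<in> mspace X \<Longrightarrow> mdist X (T p) (T q) = mdist X p q"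
    and \<gamma>: "\<And>x. x \<in> {a..b} \<Longrightarrow> x + d \<in> I \<and> \<gamma> (x + d) \<in> mspace X \<and> \<gamma>' x = T (\<gamma> (x + d))"
  shows "morse X M {a..b} \<gamma>'"
  unfolding morse_def
proof (intro allI impI ballI, elim conjE)
  fix s t k c a' b' :: real and \<eta> x
  assume st: "s \<le> t" "{s..t} \<subseteq> {a..b}" and k: "1 \<le> k" and c: "0 \<le> c" and ab: "a' \<le> b'"
    and qg: "quasi_geodesic X k c {a'..b'} \<eta>" and ends: "\<eta> a' = \<gamma>' s" "\<eta> b' = \<gamma>' t" and x: "x \<in> {a'..b'}"
  have stab: "s \<in> {a..b}" "t \<in> {a..b}" using st by auto
  have \<eta>: "\<eta> u \<in> mspace X" if "u \<in> {a'..b'}" for u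
    using qg that unfolding quasi_geodesic_def by blast
  have isometry': "mdist X (T' p) (T' q) = mdist X p q" if "p \<in> mspace X" "q \<in> mspace X" for p q
    using isometry[of "T' p" "T' q"] inverse(1)[OF that(1)] inverse(1)[OF that(2)] that T(2)
    by (simp add: Pi_iff)
  have "quasi_geodesic X k c {a'..b'} (T' \<circ> \<eta>)"
    using qg T(2) \<eta> isometry' unfolding quasi_geodesic_def by auto
  moreover have "(T' \<circ> \<eta>) a' = \<gamma> (s + d)" "(T' \<circ> \<eta>) b' = \<gamma> (t + d)"
    using ends \<gamma>[OF stab(1)] \<gamma>[OF stab(2)] inverse by auto
  moreover have "s + d \<le> t + d" "{s + d..t + d} \<subseteq> I"
  proof -
    have "y \<in> I" if "y \<in> {s + d..t + d}" for y
      using \<gamma>[of "y - d"] that st by auto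
    then show "{s + d..t + d} \<subseteq> I" by blast
  qed (use st in auto)
  ultimately obtain y where y: "y \<in> {s + d..t + d}" "mdist X ((T' \<circ> \<eta>) x) (\<gamma> y) \<le> M k c"
    using morse k c ab x unfolding morse_def by blast
  have y': "y - d \<in> {s..t}" using y(1) by auto
  then have "y - d \<in> {a..b}" using st(2) by blast
  from \<gamma>[OF this] have "\<gamma> y \<in> mspace X" "\<gamma>' (y - d) = T (\<gamma> y)" by auto
  then have "mdist X (\<eta> x) (\<gamma>' (y - d)) = mdist X (T' (\<eta> x)) (\<gamma> y)"
    using isometry[of "T' (\<eta> x)" "\<gamma> y"] \<eta>[OF x] inverse(1)[OF \<eta>[OF x]] T(2) by auto
  then show "\<exists>y\<in>{s..t}. mdist X (\<eta> x) (\<gamma>' y) \<le> M k c"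
    using y(2) y' by (intro bexI[of _ "y - d"]) auto
qed

lemma geodesic_on_interval_iff:
  "geodesic X {a..b} \<gamma> \<longleftrightarrow>
     a \<le> b \<and> \<gamma> ` {a..b} \<subseteq> mspace X \<and> (\<forall>s\<in>{a..b}. \<forall>t\<in>{a..b}. mdist X (\<gamma> s) (\<gamma> t) = \<bar>s - t\<bar>)"
proof -
  have "x \<le> y \<and> y \<le> x \<longleftrightarrow> y = x" for x y :: real by auto
  then show ?thesis
    unfolding geodesic_def quasi_geodesic_def by (simp add: is_interval_cc)
qed

abbreviation vertex :: "'a \<Rightarrow> 'a \<Rightarrow> real" where
  "vertex g \<equiv> edge_point g g 0"

definition word_length :: "('a, 'b) monoid_scheme \<Rightarrow> 'a set \<Rightarrow> 'a \<Rightarrow> nat" where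
  "word_length G A g = (LEAST n. \<exists>w\<in>lists A. length w = n \<and> word_val G w = g)"

definition left_translation :: "('a, 'b) monoid_scheme \<Rightarrow> 'a \<Rightarrow> ('a \<Rightarrow> real) \<Rightarrow> ('a \<Rightarrow> real)" where
  "left_translation G g p = (\<lambda>x. if x \<in> carrier G then p (inv\<^bsub>G\<^esub> g \<otimes>\<^bsub>G\<^esub> x) else 0)"

text \<open>The extension of a function on the vertices that is affine on every edge, in barycentric
  coordinates.\<close>

definition affine_extension :: "('a \<Rightarrow> real) \<Rightarrow> ('a \<Rightarrow> real) \<Rightarrow> real" where
  "affine_extension f p = (\<Sum>x | p x \<noteq> 0. p x * f x)"

lemma edge_point_0: "edge_point g h 0 = vertex g"
  and edge_point_1: "edge_point g h 1 = vertex h"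
  by (auto simp: edge_point_def)

lemma affine_extension_edge_point:
  "affine_extension f (edge_point g h t) = (1 - t) * f g + t * f h"
proof -
  have "affine_extension f (edge_point g h t) = (\<Sum>x\<in>{g, h}. edge_point g h t x * f x)"
    unfolding affine_extension_def
    by (rule sum.mono_neutral_left) (auto simp: edge_point_def indicator_def)
  then show ?thesis
    by (cases "g = h") (auto simp: edge_point_def algebra_simps)
qed

lemma affine_extension_lipschitz:
  assumes "cayley_chain G A p q l"
    and "\<And>g h. cayley_edge G A g h \<Longrightarrow> \<bar>f g - f h\<bar> \<le> 1"
  shows "\<bar>affine_extension f p - affine_extension f q\<bar> \<le> l"
  using assms(1)
proof (induction rule: cayley_chain.induct)
  case (step g h s t q l)
  have "affine_extension f (edge_point g h s) - affine_extension f (edge_point g h t) = (t - s) * (f g - f h)"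
    unfolding affine_extension_edge_point by (simp add: algebra_simps)
  then have "\<bar>affine_extension f (edge_point g h s) - affine_extension f (edge_point g h t)\<bar>
      = \<bar>s - t\<bar> * \<bar>f g - f h\<bar>"
    by (simp add: abs_mult abs_minus_commute)
  also have "\<dots> \<le> \<bar>s - t\<bar> * 1"
    by (intro mult_left_mono assms(2) step) auto
  finally have "\<bar>affine_extension f (edge_point g h s) - affine_extension f (edge_point g h t)\<bar> \<le> \<bar>s - t\<bar>"
    by simp
  with step.IH show ?case by linarith
qed simp

lemma word_path_at_nat: "word_path G w (real i) = vertex (word_val G (take i w))"
  by (simp add: word_path_def Let_def) (rule edge_point_0)

lemma word_path_on_edge:
  assumes "x \<in> {real i..real (Suc i)}"
  shows "word_path G w x = edge_point (word_val G (take i w)) (word_val G (take (Suc i) w)) (x - i)"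
proof (cases "x = real (Suc i)")
  case True
  then show ?thesis
    using word_path_at_nat[of G w "Suc i"] by (simp add: edge_point_1)
next
  case False
  then have "\<lfloor>x\<rfloor> = int i" using assms by (intro floor_unique) auto
  then show ?thesis by (simp add: word_path_def)
qed

locale cayley_group = group G for G :: "('a, 'b) monoid_scheme" (structure) +
  fixes A :: "'a set"
  assumes generators: "finite_symmetric_generating_set G A"
begin

abbreviation X :: "('a \<Rightarrow> real) metric" where "X \<equiv> cayley_graph G A"
abbreviation points :: "('a \<Rightarrow> real) set" where "points \<equiv> cayley_points G A"
abbreviation dist_X :: "('a \<Rightarrow> real) \<Rightarrow> ('a \<Rightarrow> real) \<Rightarrow> real" where "dist_X \<equiv> mdist X"
abbreviation val :: "'a list \<Rightarrow> 'a" where "val \<equiv> word_val G"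
abbreviation len :: "'a \<Rightarrow> nat" where "len \<equiv> word_length G A"

lemma finite_A: "finite A" and A_carrier: "A \<subseteq> carrier G"
  and A_inv: "a \<in> A \<Longrightarrow> inv a \<in> A" and generate_A: "generate G A = carrier G"
  using generators by (auto simp: finite_symmetric_generating_set_def)

lemma mspace_X [simp]: "mspace X = points"
  using mspace_cayley_graph[OF is_group generators] .

lemma dist_X_eq: "dist_X = cayley_dist G A"
  using mdist_cayley_graph[OF is_group generators] .

subsection \<open>Words and word length\<close>

lemma lists_A_carrier: "w \<in> lists A \<Longrightarrow> w \<in> lists (carrier G)"
  using A_carrier lists_mono by blast

lemma take_lists [intro]: "w \<in> lists B \<Longrightarrow> take i w \<in> lists B"
  by (auto dest: in_set_takeD)

lemma val_Nil [simp]: "val [] = \<one>"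
  and val_Cons [simp]: "val (a # w) = a \<otimes> val w"
  by (simp_all add: word_val_def)

lemma val_closed [simp, intro]: "w \<in> lists (carrier G) \<Longrightarrow> val w \<in> carrier G"
  by (induction w) auto

lemma val_append:
  "u \<in> lists (carrier G) \<Longrightarrow> v \<in> lists (carrier G) \<Longrightarrow> val (u @ v) = val u \<otimes> val v"
  by (induction u) (auto simp: m_assoc)

lemma inv_mult_mult [simp]:
  "g \<in> carrier G \<Longrightarrow> h \<in> carrier G \<Longrightarrow> inv g \<otimes> (g \<otimes> h) = h"
  "g \<in> carrier G \<Longrightarrow> h \<in> carrier G \<Longrightarrow> g \<otimes> (inv g \<otimes> h) = h"
  by (simp_all add: m_assoc[symmetric])

lemma word_exists: "g \<in> carrier G \<Longrightarrow> \<exists>w\<in>lists A. val w = g"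
  unfolding generate_A[symmetric]
proof (induction rule: generate.induct)
  case one
  show ?case by (intro bexI[of _ "[]"]) auto
next
  case (incl h)
  then show ?case using A_carrier by (intro bexI[of _ "[h]"]) auto
next
  case (inv h)
  then show ?case using A_carrier A_inv by (intro bexI[of _ "[inv h]"]) auto
next
  case (eng g h)
  then obtain u v where "u \<in> lists A" "val u = g" "v \<in> lists A" "val v = h" by blast
  then show ?case
    using val_append[of u v] lists_A_carrier by (intro bexI[of _ "u @ v"]) auto
qed

lemma shortest_word: "g \<in> carrier G \<Longrightarrow> \<exists>w\<in>lists A. length w = len g \<and> val w = g"
  unfolding word_length_def by (rule LeastI_ex) (use word_exists in blast)

lemma len_val_le: "w \<in> lists A \<Longrightarrow> len (val w) \<le> length w"
  unfolding word_length_def by (rule Least_le) blast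

lemma len_one [simp]: "len \<one> = 0"
  using len_val_le[of "[]"] by simp

lemma len_mult_le:
  assumes "g \<in> carrier G" "h \<in> carrier G" shows "len (g \<otimes> h) \<le> len g + len h"
proof -
  obtain u v where "u \<in> lists A" "length u = len g" "val u = g"
    and "v \<in> lists A" "length v = len h" "val v = h"
    using shortest_word assms by metis
  then show ?thesis using len_val_le[of "u @ v"] val_append[of u v] lists_A_carrier by auto
qed

lemma len_generator: "a \<in> A \<Longrightarrow> len a \<le> 1"
  using len_val_le[of "[a]"] A_carrier by auto

lemma finite_len_ball: "finite {g \<in> carrier G. real (len g) \<le> r}"
proof (rule finite_subset)
  show "{g \<in> carrier G. real (len g) \<le> r} \<subseteq> val ` {w. set w \<subseteq> A \<and> length w \<le> nat \<lfloor>r\<rfloor>}"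
  proof (clarsimp)
    fix g assume g: "g \<in> carrier G" "real (len g) \<le> r"
    then obtain w where w: "w \<in> lists A" "length w = len g" "val w = g" using shortest_word by blast
    moreover have "len g \<le> nat \<lfloor>r\<rfloor>" using g(2) by (simp add: le_nat_floor)
    ultimately show "g \<in> val ` {w. set w \<subseteq> A \<and> length w \<le> nat \<lfloor>r\<rfloor>}" by auto
  qed
qed (simp add: finite_A finite_lists_length_le)

subsection \<open>Distances\<close>

lemma vertex_in_points [simp, intro]: "g \<in> carrier G \<Longrightarrow> vertex g \<in> points"
  by (auto simp: cayley_points_def)

lemma edge_point_in_points: "cayley_edge G A g h \<Longrightarrow> t \<in> {0..1} \<Longrightarrow> edge_point g h t \<in> points"
  by (auto simp: cayley_points_def)

lemma edge_generator: "g \<in> carrier G \<Longrightarrow> a \<in> A \<Longrightarrow> cayley_edge G A g (g \<otimes> a)"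
  using A_carrier by (auto simp: cayley_edge_def)

lemma dist_le_chain:
  assumes "cayley_chain G A p q l" "p \<in> points" "q \<in> points" shows "dist_X p q \<le> l"
proof -
  have "bdd_below {l. cayley_chain G A p q l}"
    using cayley_chain_nonneg by (intro bdd_belowI[of _ 0]) auto
  then show ?thesis
    using cInf_lower[of l "{l. cayley_chain G A p q l}"] assms by (simp add: dist_X_eq cayley_dist_def)
qed

lemma le_dist_chain:
  assumes "\<And>l. cayley_chain G A p q l \<Longrightarrow> r \<le> l" "p \<in> points" "q \<in> points"
  shows "r \<le> dist_X p q"
proof -
  have "{l. cayley_chain G A p q l} \<noteq> {}"
    using cayley_chain_exists[OF is_group generators assms(2,3)] by blast
  then show ?thesis
    using cInf_greatest[of "{l. cayley_chain G A p q l}" r] assms by (simp add: dist_X_eq cayley_dist_def)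
qed

lemma dist_edge_le:
  assumes "cayley_edge G A g h" "s \<in> {0..1}" "t \<in> {0..1}"
  shows "dist_X (edge_point g h s) (edge_point g h t) \<le> \<bar>s - t\<bar>"
  using assms cayley_chain_edge edge_point_in_points dist_le_chain by metis

text \<open>The path of a word bounds the distance from above. For the other bound, the word length
  \<open>x \<mapsto> len (inv g \<otimes> x)\<close> is \<open>1\<close>-Lipschitz along edges between vertices, hence so is its affine
  extension along chains.\<close>

lemma dist_vertex:
  assumes g: "g \<in> carrier G" and h: "h \<in> carrier G"
  shows "dist_X (vertex g) (vertex h) = len (inv g \<otimes> h)"
proof (rule antisym)
  have chain: "cayley_chain G A (vertex k) (vertex (k \<otimes> val w)) (length w)"
    if "w \<in> lists A" "k \<in> carrier G" for w k
    using that
  proof (induction w arbitrary: k)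
    case Nil
    then show ?case using cayley_chain.refl by simp
  next
    case (Cons a w)
    then have a: "a \<in> A" "a \<in> carrier G" "w \<in> lists A" "val w \<in> carrier G"
      using A_carrier lists_A_carrier by auto
    have "cayley_chain G A (vertex (k \<otimes> a)) (vertex (k \<otimes> a \<otimes> val w)) (length w)"
      using Cons a by auto
    then have "cayley_chain G A (edge_point k (k \<otimes> a) 0) (vertex (k \<otimes> a \<otimes> val w)) (\<bar>0 - 1 :: real\<bar> + real (length w))"
      using a Cons.prems by (intro cayley_chain.step edge_generator) (auto simp: edge_point_1)
    then show ?case using a Cons.prems by (simp add: edge_point_0[of k "k \<otimes> a"] m_assoc)
  qed
  obtain w where w: "w \<in> lists A" "length w = len (inv g \<otimes> h)" "val w = inv g \<otimes> h"
    using shortest_word g h by blast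
  show "dist_X (vertex g) (vertex h) \<le> len (inv g \<otimes> h)"
    using dist_le_chain[OF chain[OF w(1) g]] w g h by auto
  define f where "f x = real (len (inv g \<otimes> x))" for x
  have "\<bar>f x - f y\<bar> \<le> 1" if e: "cayley_edge G A x y" for x y
  proof -
    define a where "a = inv x \<otimes> y"
    have x: "x \<in> carrier G" and y: "y \<in> carrier G" and a: "a \<in> A" "a \<in> carrier G"
      using e A_carrier by (auto simp: cayley_edge_def a_def)
    have "y = x \<otimes> a" using x y by (simp add: a_def)
    moreover have "x = y \<otimes> inv a" using x y by (simp add: a_def inv_mult_group)
    ultimately have "inv g \<otimes> y = inv g \<otimes> x \<otimes> a" "inv g \<otimes> x = inv g \<otimes> y \<otimes> inv a"
      using x y a g by (metis inv_closed m_assoc)+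
    then have "len (inv g \<otimes> y) \<le> len (inv g \<otimes> x) + len a" "len (inv g \<otimes> x) \<le> len (inv g \<otimes> y) + len (inv a)"
      using len_mult_le x y a g by (metis inv_closed m_closed)+
    then show ?thesis using len_generator[OF a(1)] len_generator[OF A_inv[OF a(1)]] by (simp add: f_def)
  qed
  then have "\<bar>affine_extension f (vertex g) - affine_extension f (vertex h)\<bar> \<le> l"
    if "cayley_chain G A (vertex g) (vertex h) l" for l
    using affine_extension_lipschitz[OF that] by blast
  then have "f h \<le> l" if "cayley_chain G A (vertex g) (vertex h) l" for l
    using that g unfolding affine_extension_edge_point by (fastforce simp: f_def)
  then show "real (len (inv g \<otimes> h)) \<le> dist_X (vertex g) (vertex h)"
    using g h unfolding f_def by (intro le_dist_chain) auto
qed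

lemma dist_vertex_one: "g \<in> carrier G \<Longrightarrow> dist_X (vertex \<one>) (vertex g) = len g"
  using dist_vertex[of \<one> g] by simp

lemma near_vertex: "p \<in> points \<Longrightarrow> \<exists>g\<in>carrier G. dist_X p (vertex g) \<le> 1"
  unfolding cayley_points_def
proof (elim UnE)
  assume "p \<in> {vertex g | g. g \<in> carrier G}"
  then obtain g where "g \<in> carrier G" "p = vertex g" by blast
  then show ?thesis by (intro bexI[of _ g]) (auto simp: mdist_self)
next
  assume "p \<in> {edge_point g h t | g h t. cayley_edge G A g h \<and> t \<in> {0..1}}"
  then obtain g h t where *: "cayley_edge G A g h" "t \<in> {0..1}" "p = edge_point g h t" by blast
  then show ?thesis
    using dist_edge_le[OF *(1,2), of 0] by (intro bexI[of _ g]) (auto simp: edge_point_0[of g h] cayley_edge_def)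
qed

subsection \<open>Word paths\<close>

lemma val_take_closed [simp]: "w \<in> lists A \<Longrightarrow> val (take i w) \<in> carrier G"
  by (intro val_closed lists_A_carrier take_lists)

lemma val_take_Suc:
  assumes "w \<in> lists A" "i < length w"
  shows "val (take (Suc i) w) = val (take i w) \<otimes> w ! i"
proof -
  have "w ! i \<in> A" using assms by auto
  then have "w ! i \<in> carrier G" using A_carrier by (rule subsetD[rotated])
  moreover have "take i w \<in> lists (carrier G)" using assms(1) by (intro lists_A_carrier take_lists)
  ultimately show ?thesis
    using val_append[of "take i w" "[w ! i]"] assms by (simp add: take_Suc_conv_app_nth)
qed

lemma word_path_edge:
  assumes "w \<in> lists A" "i < length w"
  shows "cayley_edge G A (val (take i w)) (val (take (Suc i) w))"
  unfolding val_take_Suc[OF assms] using assms val_take_closed[OF assms(1)]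
  by (intro edge_generator) auto

lemma on_some_edge:
  assumes "x \<in> {0..real n}" "n > 0"
  obtains i where "i < n" "x \<in> {real i..real (Suc i)}"
proof (cases "x = real n")
  case True
  then show ?thesis using assms that[of "n - 1"] by (auto simp: of_nat_diff)
next
  case False
  then have "x < real n" "x \<ge> 0" using assms by auto
  then show ?thesis using that[of "nat \<lfloor>x\<rfloor>"] by (auto simp: nat_less_iff floor_less_iff) linarith+
qed

lemma word_path_in_points:
  assumes "w \<in> lists A" "x \<in> {0..real (length w)}" shows "word_path G w x \<in> points"
proof (cases "length w = 0")
  case True
  then show ?thesis using assms word_path_at_nat[of G w 0] by auto
next
  case False
  then obtain i where i: "i < length w" "x \<in> {real i..real (Suc i)}"
    using on_some_edge[OF assms(2)] by auto
  show ?thesis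
    unfolding word_path_on_edge[OF i(2)]
    by (rule edge_point_in_points[OF word_path_edge[OF assms(1) i(1)]]) (use i in auto)
qed

lemma word_path_lipschitz:
  assumes w: "w \<in> lists A" and s: "s \<in> {0..real (length w)}" and t: "t \<in> {0..real (length w)}"
  shows "dist_X (word_path G w s) (word_path G w t) \<le> \<bar>s - t\<bar>"
proof -
  let ?\<gamma> = "word_path G w"
  have same_edge: "dist_X (?\<gamma> s) (?\<gamma> t) \<le> \<bar>s - t\<bar>"
    if "i < length w" "s \<in> {real i..real (Suc i)}" "t \<in> {real i..real (Suc i)}" for s t i
  proof -
    have "dist_X (?\<gamma> s) (?\<gamma> t) \<le> \<bar>(s - i) - (t - i)\<bar>"
      unfolding word_path_on_edge[OF that(2)] word_path_on_edge[OF that(3)]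
      by (rule dist_edge_le[OF word_path_edge[OF w that(1)]]) (use that in auto)
    then show ?thesis by simp
  qed
  have ordered: "dist_X (?\<gamma> s) (?\<gamma> t) \<le> t - s"
    if "j \<le> length w" "0 \<le> s" "s \<le> t" "t \<le> real j" for s t j
    using that
  proof (induction j arbitrary: s t)
    case 0
    then have "s = 0" "t = 0" by auto
    then show ?case using word_path_in_points[OF w, of 0] by (simp add: mdist_self)
  next
    case (Suc j)
    show ?case
    proof (cases "t \<le> real j")
      case True
      then show ?thesis using Suc by auto
    next
      case tj: False
      show ?thesis
      proof (cases "s \<ge> real j")
        case True
        then show ?thesis using same_edge[of j s t] tj Suc.prems by auto
      next
        case False
        have "dist_X (?\<gamma> s) (?\<gamma> t) \<le> dist_X (?\<gamma> s) (?\<gamma> j) + dist_X (?\<gamma> j) (?\<gamma> t)"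
          by (rule mdist_triangle) (use word_path_in_points[OF w] Suc.prems tj False in auto)
        moreover have "dist_X (?\<gamma> s) (?\<gamma> j) \<le> j - s" using Suc False by auto
        moreover have "dist_X (?\<gamma> j) (?\<gamma> t) \<le> t - j"
          using same_edge[of j "real j" t] tj Suc.prems by auto
        ultimately show ?thesis by linarith
      qed
    qed
  qed
  show ?thesis
  proof (cases "s \<le> t")
    case True
    then show ?thesis using ordered[of "length w" s t] s t by auto
  next
    case False
    then show ?thesis using ordered[of "length w" t s] s t by (auto simp: mdist_commute)
  qed
qed

text \<open>A \<open>1\<close>-Lipschitz path whose ends are as far apart as possible is isometric.\<close>

lemma geodesic_word_iff:
  "geodesic_word G A w \<longleftrightarrow> w \<in> lists A \<and> len (val w) = length w"
proof (cases "w \<in> lists A")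
  case w: True
  let ?\<gamma> = "word_path G w" and ?n = "real (length w)"
  have closed: "val w \<in> carrier G" using lists_A_carrier[OF w] by blast
  have ends: "dist_X (?\<gamma> 0) (?\<gamma> ?n) = len (val w)"
    using word_path_at_nat[of G w 0] word_path_at_nat[of G w "length w"] closed
    by (simp add: dist_vertex_one)
  have iff: "geodesic X {0..?n} ?\<gamma> \<longleftrightarrow> (\<forall>s\<in>{0..?n}. \<forall>t\<in>{0..?n}. dist_X (?\<gamma> s) (?\<gamma> t) = \<bar>s - t\<bar>)"
    unfolding geodesic_on_interval_iff using word_path_in_points[OF w] by auto
  have "geodesic X {0..?n} ?\<gamma>" if eq: "len (val w) = length w"
    unfolding iff
  proof (intro ballI)
    fix s t assume st: "s \<in> {0..?n}" "t \<in> {0..?n}"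
    have ineq: "t - s \<le> dist_X (?\<gamma> s) (?\<gamma> t)" if st: "s \<in> {0..?n}" "t \<in> {0..?n}" for s t
    proof -
      have "dist_X (?\<gamma> 0) (?\<gamma> ?n) \<le> dist_X (?\<gamma> 0) (?\<gamma> s) + dist_X (?\<gamma> s) (?\<gamma> t) + dist_X (?\<gamma> t) (?\<gamma> ?n)"
        by (rule mdist_triangle3) (use word_path_in_points[OF w] st in auto)
      moreover have "dist_X (?\<gamma> 0) (?\<gamma> s) \<le> s" "dist_X (?\<gamma> t) (?\<gamma> ?n) \<le> ?n - t"
        using word_path_lipschitz[OF w, of 0 s] word_path_lipschitz[OF w, of t ?n] st by auto
      ultimately show ?thesis using ends eq by linarith
    qed
    show "dist_X (?\<gamma> s) (?\<gamma> t) = \<bar>s - t\<bar>"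
      using ineq[OF st] ineq[OF st(2,1)] word_path_lipschitz[OF w st]
      by (auto simp: mdist_commute)
  qed
  moreover have "len (val w) = length w" if "geodesic X {0..?n} ?\<gamma>"
    using that ends unfolding iff by auto
  ultimately show ?thesis using w unfolding geodesic_word_def by blast
qed (simp add: geodesic_word_def)

lemma geodesic_word_dist:
  assumes "geodesic_word G A w" "s \<in> {0..real (length w)}" "t \<in> {0..real (length w)}"
  shows "dist_X (word_path G w s) (word_path G w t) = \<bar>s - t\<bar>"
  using assms unfolding geodesic_word_def geodesic_on_interval_iff by blast

subsection \<open>Left translations\<close>

lemma left_translation_edge_point:
  assumes "g \<in> carrier G" "x \<in> carrier G" "y \<in> carrier G"
  shows "left_translation G g (edge_point x y t) = edge_point (g \<otimes> x) (g \<otimes> y) t"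
proof
  fix z
  have "inv g \<otimes> z = u \<longleftrightarrow> z = g \<otimes> u" if "z \<in> carrier G" "u \<in> carrier G" for u
    using that assms(1) by auto
  then show "left_translation G g (edge_point x y t) z = edge_point (g \<otimes> x) (g \<otimes> y) t z"
    using assms by (auto simp: left_translation_def edge_point_def indicator_def)
qed

lemma left_translation_edge:
  assumes "g \<in> carrier G" "cayley_edge G A x y" shows "cayley_edge G A (g \<otimes> x) (g \<otimes> y)"
  using assms by (auto simp: cayley_edge_def inv_mult_group m_assoc)

lemma left_translation_points:
  assumes "g \<in> carrier G" "p \<in> points" shows "left_translation G g p \<in> points"
  using assms left_translation_edge[OF assms(1)]
  unfolding cayley_points_def
  by (auto simp: left_translation_edge_point cayley_edge_def) blast+

lemma left_translation_inverse:
  assumes "g \<in> carrier G" "p \<in> points"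
  shows "left_translation G (inv g) (left_translation G g p) = p"
  using assms by (auto simp: cayley_points_def left_translation_edge_point cayley_edge_def)

lemma left_translation_chain:
  assumes "cayley_chain G A p q l" "g \<in> carrier G"
  shows "cayley_chain G A (left_translation G g p) (left_translation G g q) l"
  using assms(1)
proof (induction rule: cayley_chain.induct)
  case (step x y s t q l)
  then have "x \<in> carrier G" "y \<in> carrier G" by (auto simp: cayley_edge_def)
  with step show ?case
    using cayley_chain.step[OF left_translation_edge[OF assms(2) step(1)] step(2,3)]
    by (simp add: left_translation_edge_point assms(2))
qed (rule cayley_chain.refl)

lemma left_translation_dist:
  assumes g: "g \<in> carrier G" and p: "p \<in> points" and q: "q \<in> points"
  shows "dist_X (left_translation G g p) (left_translation G g q) = dist_X p q"
proof -
  have le: "dist_X (left_translation G g p) (left_translation G g q) \<le> dist_X p q"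
    if "g \<in> carrier G" "p \<in> points" "q \<in> points" for g p q
    using that left_translation_chain left_translation_points
    by (intro le_dist_chain dist_le_chain) auto
  from le[OF g p q] le[of "inv g" "left_translation G g p" "left_translation G g q"]
  show ?thesis using g p q left_translation_points left_translation_inverse by auto
qed

lemma word_path_infix:
  assumes w: "x @ y @ z \<in> lists A" and r: "r \<in> {0..real (length y)}"
  shows "word_path G (x @ y @ z) (r + length x) = left_translation G (val x) (word_path G y r)"
proof -
  have xyz: "x \<in> lists (carrier G)" "y \<in> lists (carrier G)" "z \<in> lists (carrier G)"
    using lists_A_carrier[OF w] by auto
  then have xi: "val (take (i + length x) (x @ y @ z)) = val x \<otimes> val (take i y)" if "i \<le> length y" for i
    using that val_append[OF xyz(1) take_lists[OF xyz(2)], of i] by simp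
  show ?thesis
  proof (cases "length y = 0")
    case True
    then show ?thesis using r xyz word_path_at_nat[of G "x @ y @ z" "length x"] word_path_at_nat[of G y 0]
      by (auto simp: left_translation_edge_point)
  next
    case False
    then obtain i where i: "i < length y" "r \<in> {real i..real (Suc i)}"
      using on_some_edge[OF r] by auto
    have "word_path G (x @ y @ z) (r + length x)
        = edge_point (val (take (i + length x) (x @ y @ z))) (val (take (Suc (i + length x)) (x @ y @ z)))
            (r + length x - real (i + length x))"
      by (rule word_path_on_edge) (use i in auto)
    also have "\<dots> = edge_point (val x \<otimes> val (take i y)) (val x \<otimes> val (take (Suc i) y)) (r - i)"
      using xi[of i] xi[of "Suc i"] i by simp
    also have "\<dots> = left_translation G (val x) (word_path G y r)"
      unfolding word_path_on_edge[OF i(2)] using xyz(1) w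
      by (subst left_translation_edge_point) auto
    finally show ?thesis .
  qed
qed

text \<open>Word length is subadditive, so a shorter spelling of an infix would shorten the whole word.\<close>

lemma geodesic_word_infix:
  assumes "geodesic_word G A (x @ y @ z)" shows "geodesic_word G A y"
proof -
  have A: "x \<in> lists A" "y \<in> lists A" "z \<in> lists A" and eq: "len (val (x @ y @ z)) = length (x @ y @ z)"
    using assms unfolding geodesic_word_iff by auto
  note C = lists_A_carrier[OF A(1)] lists_A_carrier[OF A(2)] lists_A_carrier[OF A(3)]
  note D = val_closed[OF C(1)] val_closed[OF C(2)] val_closed[OF C(3)]
  have "val (x @ y @ z) = val x \<otimes> (val y \<otimes> val z)"
    using val_append[of x "y @ z"] val_append[OF C(2,3)] C by simp
  moreover have "len (val x \<otimes> (val y \<otimes> val z)) \<le> len (val x) + (len (val y) + len (val z))"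
    using len_mult_le[OF D(1), of "val y \<otimes> val z"] len_mult_le[OF D(2,3)] D by simp
  ultimately have "len (val (x @ y @ z)) \<le> len (val x) + (len (val y) + len (val z))"
    by simp
  then show ?thesis
    unfolding geodesic_word_iff using eq A len_val_le[of x] len_val_le[of y] len_val_le[of z] by auto
qed

text \<open>Left translations carry the path of an infix to a subpath, so being a Morse geodesic passes to
  infixes with the same gauge.\<close>

lemma morse_geodesic_word_infix:
  assumes "morse_geodesic_word G A M (x @ y @ z)" shows "morse_geodesic_word G A M y"
proof -
  let ?w = "x @ y @ z"
  have w: "?w \<in> lists A" and x: "val x \<in> carrier G" and y: "y \<in> lists A"
    using assms lists_A_carrier unfolding morse_geodesic_word_def geodesic_word_def by auto
  have "morse X M {0..real (length y)} (word_path G y)"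
  proof (rule morse_isometry[where T = "left_translation G (inv (val x))" and T' = "left_translation G (val x)"
        and d = "length x"])
    show "morse X M {0..real (length ?w)} (word_path G ?w)"
      using assms unfolding morse_geodesic_word_def by blast
    fix r assume r: "r \<in> {0..real (length y)}"
    show "r + length x \<in> {0..real (length ?w)} \<and> word_path G ?w (r + length x) \<in> mspace X \<and>
        word_path G y r = left_translation G (inv (val x)) (word_path G ?w (r + length x))"
      using word_path_infix[OF w r] word_path_in_points[OF w, of "r + length x"]
        left_translation_inverse[OF x word_path_in_points[OF y r]] r by auto
  qed (use x left_translation_points left_translation_dist left_translation_inverse[of "inv (val x)"]
      left_translation_inverse[of "val x"] in auto)
  then show ?thesis
    using assms geodesic_word_infix unfolding morse_geodesic_word_def by blast
qed

text \<open>Conversely, a bound on the infixes gives a bound on the pieces of the path between real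
  parameters: a piece of length at most \<open>B\<close> lies in the path of an infix of length at most
  \<open>\<lceil>B\<rceil> + 1\<close>.\<close>

lemma local_morse_word_path:
  assumes w: "w \<in> lists A"
    and infixes: "\<And>x y z. w = x @ y @ z \<Longrightarrow> length y \<le> nat \<lceil>B\<rceil> + 1 \<Longrightarrow> morse_geodesic_word G A M y"
  shows "local_morse_quasi_geodesic X B M 1 0 {0..real (length w)} (word_path G w)"
  unfolding local_morse_quasi_geodesic_def
proof (intro conjI allI impI; (elim conjE)?)
  fix s t :: real assume st: "s \<le> t" "{s..t} \<subseteq> {0..real (length w)}" "\<bar>s - t\<bar> \<le> B"
  then have s: "0 \<le> s" "s \<le> length w" and t: "0 \<le> t" "t \<le> length w" by auto
  define i where "i = nat \<lfloor>s\<rfloor>"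
  define y where "y = take (nat \<lceil>B\<rceil> + 1) (drop i w)"
  define x where "x = take i w"
  define z where "z = drop (nat \<lceil>B\<rceil> + 1) (drop i w)"
  have wxyz: "w = x @ y @ z" unfolding x_def y_def z_def append_take_drop_id ..
  have i: "real i \<le> s" "s < real i + 1" using s by (auto simp: i_def)
  then have lx: "length x = i" using s by (simp add: x_def)
  have "t \<le> real i + (nat \<lceil>B\<rceil> + 1)" using st i by linarith
  then have ty: "t \<le> real (length y) + length x"
    using t lx i s by (auto simp: y_def min_def)
  have x: "val x \<in> carrier G" and y: "y \<in> lists A" using w lists_A_carrier unfolding wxyz by auto
  have my: "morse_geodesic_word G A M y" using infixes[OF wxyz] by (simp add: y_def)
  have shift: "r - length x \<in> {0..real (length y)}" if "r \<in> {s..t}" for r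
    using that i lx ty by auto
  have translate: "word_path G w r = left_translation G (val x) (word_path G y (r - length x))"
    if "r \<in> {s..t}" for r
    using word_path_infix[of x y z "r - length x"] w shift[OF that] by (simp add: wxyz)
  have "quasi_geodesic X 1 0 {s..t} (word_path G w)"
  proof -
    have "dist_X (word_path G w r) (word_path G w r') = \<bar>r - r'\<bar>" if r: "r \<in> {s..t}" "r' \<in> {s..t}" for r r'
    proof -
      have "dist_X (word_path G w r) (word_path G w r')
          = dist_X (word_path G y (r - length x)) (word_path G y (r' - length x))"
        using translate r left_translation_dist[OF x] word_path_in_points[OF y] shift by auto
      also have "\<dots> = \<bar>(r - length x) - (r' - length x)\<bar>"
        using my shift r by (intro geodesic_word_dist) (auto simp: morse_geodesic_word_def)
      finally show ?thesis by simp
    qed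
    moreover have "word_path G w ` {s..t} \<subseteq> points" using word_path_in_points[OF w] st(2) by blast
    ultimately show ?thesis
      using st(1) geodesic_on_interval_iff[of X s t] unfolding geodesic_def by auto
  qed
  moreover have "morse X M {s..t} (word_path G w)"
  proof (rule morse_isometry[where T = "left_translation G (val x)" and T' = "left_translation G (inv (val x))"
        and d = "- real (length x)"])
    show "morse X M {0..real (length y)} (word_path G y)"
      using my unfolding morse_geodesic_word_def by blast
    fix r assume r: "r \<in> {s..t}"
    show "r + - real (length x) \<in> {0..real (length y)} \<and> word_path G y (r + - real (length x)) \<in> mspace X \<and>
        word_path G w r = left_translation G (val x) (word_path G y (r + - real (length x)))"
      using shift[OF r] translate[OF r] word_path_in_points[OF y shift[OF r]] by simp
  qed (use x left_translation_points left_translation_dist left_translation_inverse[of "inv (val x)"]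
      left_translation_inverse[of "val x"] in auto)
  ultimately show "morse_quasi_geodesic X M 1 0 {s..t} (word_path G w)"
    unfolding morse_quasi_geodesic_def by blast
qed (use word_path_in_points[OF w] in \<open>auto simp: is_interval_cc\<close>)

end

section \<open>Change of generating set\<close>

text \<open>The two Cayley graphs have the same vertices, and a shortest word over one generating set
  becomes a word over the other one that is longer by at most a constant factor.\<close>

lemma (in cayley_group) word_length_bound:
  assumes "cayley_group G S"
  obtains C :: real where "C \<ge> 0" "\<And>g. g \<in> carrier G \<Longrightarrow> real (word_length G S g) \<le> C * len g"
proof -
  interpret S: cayley_group G S by fact
  obtain C where C: "\<forall>n\<in>S.len ` A. n \<le> C"
    using finite_nat_set_iff_bounded_le[of "S.len ` A"] finite_A by auto
  have "S.len (val w) \<le> C * length w" if "w \<in> lists A" for w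
    using that
  proof (induction w)
    case (Cons a w)
    then have "S.len (a \<otimes> val w) \<le> S.len a + S.len (val w)"
      using A_carrier lists_A_carrier by (intro S.len_mult_le) auto
    then show ?case using Cons C by fastforce
  qed simp
  then have "S.len g \<le> C * len g" if "g \<in> carrier G" for g
    using shortest_word[OF that] by metis
  then have "real (S.len g) \<le> real C * len g" if "g \<in> carrier G" for g
    using that by (metis of_nat_le_iff of_nat_mult)
  then show ?thesis using that[of "real C"] by auto
qed

definition nearby_vertex :: "('a, 'b) monoid_scheme \<Rightarrow> 'a set \<Rightarrow> ('a \<Rightarrow> real) \<Rightarrow> 'a" where
  "nearby_vertex G A p = (SOME g. g \<in> carrier G \<and> mdist (cayley_graph G A) p (vertex g) \<le> 1)"

lemma (in cayley_group) nearby_vertex: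
  assumes "p \<in> points"
  shows "nearby_vertex G A p \<in> carrier G" "dist_X p (vertex (nearby_vertex G A p)) \<le> 1"
  using someI_ex[of "\<lambda>g. g \<in> carrier G \<and> dist_X p (vertex g) \<le> 1"] near_vertex[OF assms]
  unfolding nearby_vertex_def by blast+

lemma (in cayley_group) coarse_equivalence_generating_sets:
  assumes "cayley_group G S"
  shows "\<exists>K \<phi> \<psi>. coarse_equivalence K (cayley_graph G S) (cayley_graph G A) \<phi> \<psi>"
proof -
  (* What a coarse equivalence asks of the map from the graph of S to the graph of T. The map back is
     handled by exchanging S with T and C with D. *)
  have half: "mdist (cayley_graph G T) (vertex (nearby_vertex G S p)) (vertex (nearby_vertex G S q))
        \<le> K * mdist (cayley_graph G S) p q + K
      \<and> mdist (cayley_graph G S) (vertex (nearby_vertex G T (vertex (nearby_vertex G S p)))) p \<le> K"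
    if S: "cayley_group G S" and T: "cayley_group G T"
      and C: "C \<ge> 0" "\<And>g. g \<in> carrier G \<Longrightarrow> real (word_length G T g) \<le> C * word_length G S g"
      and D: "D \<ge> 0" "\<And>g. g \<in> carrier G \<Longrightarrow> real (word_length G S g) \<le> D * word_length G T g"
      and K: "K = 2 * C + 2 * D + 1"
      and p: "p \<in> cayley_points G S" and q: "q \<in> cayley_points G S" for S T p q and C D K :: real
  proof -
    interpret S: cayley_group G S by fact
    interpret T: cayley_group G T by fact
    have SVT: "S.dist_X (vertex g) (vertex h) \<le> D * T.dist_X (vertex g) (vertex h)"
      and TVS: "T.dist_X (vertex g) (vertex h) \<le> C * S.dist_X (vertex g) (vertex h)"
      if "g \<in> carrier G" "h \<in> carrier G" for g h
      using C(2)[of "inv g \<otimes> h"] D(2)[of "inv g \<otimes> h"] that S.dist_vertex T.dist_vertex by auto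
    let ?p = "nearby_vertex G S p" and ?q = "nearby_vertex G S q"
    have p': "?p \<in> carrier G" "S.dist_X p (vertex ?p) \<le> 1" using S.nearby_vertex[OF p] .
    have q': "?q \<in> carrier G" "S.dist_X q (vertex ?q) \<le> 1" using S.nearby_vertex[OF q] .
    have "S.dist_X (vertex ?p) (vertex ?q) \<le> S.dist_X (vertex ?p) p + S.dist_X p q + S.dist_X q (vertex ?q)"
      by (rule mdist_triangle3) (use p q p' q' in auto)
    then have "S.dist_X (vertex ?p) (vertex ?q) \<le> S.dist_X p q + 2"
      using p' q' by (simp add: mdist_commute)
    then have "C * S.dist_X (vertex ?p) (vertex ?q) \<le> C * (S.dist_X p q + 2)"
      using C(1) by (rule mult_left_mono)
    then have "T.dist_X (vertex ?p) (vertex ?q) \<le> C * S.dist_X p q + 2 * C"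
      using TVS[OF p'(1) q'(1)] by (simp add: algebra_simps)
    also have "\<dots> \<le> K * S.dist_X p q + K"
      using C D K by (intro add_mono mult_right_mono) auto
    finally have 1: "T.dist_X (vertex ?p) (vertex ?q) \<le> K * S.dist_X p q + K" .
    let ?r = "nearby_vertex G T (vertex ?p)"
    have r: "?r \<in> carrier G" "T.dist_X (vertex ?p) (vertex ?r) \<le> 1"
      using T.nearby_vertex[of "vertex ?p"] p' by auto
    have "S.dist_X p (vertex ?r) \<le> S.dist_X p (vertex ?p) + S.dist_X (vertex ?p) (vertex ?r)"
      by (rule mdist_triangle) (use p p' r in auto)
    moreover have "D * T.dist_X (vertex ?p) (vertex ?r) \<le> D * 1"
      using r(2) D(1) by (rule mult_left_mono)
    ultimately have "S.dist_X (vertex ?r) p \<le> K"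
      using SVT[OF p'(1) r(1)] p'(2) C D K by (simp add: mdist_commute)
    with 1 show ?thesis by blast
  qed
  interpret S: cayley_group G S by fact
  obtain C :: real where C: "C \<ge> 0" "\<And>g. g \<in> carrier G \<Longrightarrow> real (S.len g) \<le> C * len g"
    using word_length_bound[OF assms] by blast
  obtain D :: real where D: "D \<ge> 0" "\<And>g. g \<in> carrier G \<Longrightarrow> real (len g) \<le> D * S.len g"
    using S.word_length_bound[OF cayley_group_axioms] by blast
  let ?K = "2 * C + 2 * D + 1"
  have K: "?K = 2 * D + 2 * C + 1" by simp
  note to_A = half[OF assms cayley_group_axioms D(1,2) C(1,2) K]
  note to_S = half[OF cayley_group_axioms assms C(1,2) D(1,2) HOL.refl[of ?K]]
  have "coarse_equivalence ?K (cayley_graph G S) X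
      (\<lambda>p. vertex (nearby_vertex G S p)) (\<lambda>p. vertex (nearby_vertex G A p))"
    unfolding coarse_equivalence_def mspace_X S.mspace_X
    using to_A to_S C(1) D(1) nearby_vertex(1) S.nearby_vertex(1) by (auto simp: Pi_iff)
  then show ?thesis by blast
qed

lemma (in cayley_group) morse_local_to_global_Cayley_graph:
  assumes "morse_local_to_global_group G" shows "morse_local_to_global_space X"
proof -
  obtain S where "finite_symmetric_generating_set G S" "morse_local_to_global_space (cayley_graph G S)"
    using assms unfolding morse_local_to_global_group_def by blast
  then show ?thesis
    using coarse_equivalence_generating_sets[of S] morse_local_to_global_coarse_equivalence
    by (auto simp: cayley_group_def cayley_group_axioms_def is_group)
qed

section \<open>Regular languages\<close>

text \<open>Regularity in the form in which it is used below: a quantity with finitely many values that can be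
  updated letter by letter decides membership. The automaton has the values as states.\<close>

lemma regular_languageI:
  fixes f :: "'a list \<Rightarrow> 's"
  assumes finite: "finite (f ` lists A)"
    and step: "\<And>w a. w \<in> lists A \<Longrightarrow> a \<in> A \<Longrightarrow> f (w @ [a]) = \<delta> (f w) a"
    and L: "L = {w \<in> lists A. P (f w)}"
  shows "regular_language A L"
proof -
  obtain e :: "'s \<Rightarrow> nat" where e: "inj_on e (f ` lists A)"
    using finite_imp_inj_to_nat_seg[OF finite] by blast
  define \<delta>' where "\<delta>' q a = e (\<delta> (inv_into (f ` lists A) e q) a)" for q a
  have step': "\<delta>' (e (f w)) a = e (f (w @ [a]))" if "w \<in> lists A" "a \<in> A" for w a
    using that step e by (simp add: \<delta>'_def)
  have run: "foldl \<delta>' (e (f [])) w = e (f w)" if "w \<in> lists A" for w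
    using that by (induction w rule: rev_induct) (auto simp: step')
  let ?Q = "e ` f ` lists A" and ?F = "e ` {s \<in> f ` lists A. P s}"
  have "L = {w \<in> lists A. foldl \<delta>' (e (f [])) w \<in> ?F}"
  proof -
    have "e (f w) \<in> ?F \<longleftrightarrow> P (f w)" if "w \<in> lists A" for w
      using e that by (auto dest: inj_onD)
    then have "w \<in> lists A \<and> P (f w) \<longleftrightarrow> w \<in> lists A \<and> foldl \<delta>' (e (f [])) w \<in> ?F" for w
      using run by metis
    then show ?thesis unfolding L by (rule Collect_cong)
  qed
  moreover have "\<delta>' q a \<in> ?Q" if q: "q \<in> ?Q" and a: "a \<in> A" for q a
  proof -
    obtain w where w: "w \<in> lists A" "q = e (f w)" using q by blast
    then have "w @ [a] \<in> lists A" using a by simp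
    then show ?thesis using step'[OF w(1) a] w(2) by (metis imageI)
  qed
  moreover have "e (f []) \<in> ?Q" by blast
  moreover have "?F \<subseteq> ?Q" by blast
  ultimately show ?thesis
    unfolding regular_language_def
    by (intro exI[of _ ?Q] exI[of _ "e (f [])"] exI[of _ ?F] exI[of _ \<delta>'] conjI ballI finite_imageI finite)
qed

lemma regular_languageE:
  assumes "regular_language A L"
  obtains f :: "'a list \<Rightarrow> nat" and \<delta> P where "finite (f ` lists A)"
    "\<And>w a. w \<in> lists A \<Longrightarrow> a \<in> A \<Longrightarrow> f (w @ [a]) = \<delta> (f w) a"
    "\<And>w. w \<in> L \<longleftrightarrow> w \<in> lists A \<and> P (f w)"
proof -
  obtain Q :: "nat set" and q0 F \<delta> where *: "finite Q" "q0 \<in> Q" "\<forall>q\<in>Q. \<forall>a\<in>A. \<delta> q a \<in> Q"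
    "L = {w \<in> lists A. foldl \<delta> q0 w \<in> F}"
    using assms unfolding regular_language_def by blast
  have "foldl \<delta> q0 w \<in> Q" if "w \<in> lists A" for w
    using that by (induction w rule: rev_induct) (use * in auto)
  then have "finite (foldl \<delta> q0 ` lists A)"
    using *(1) by (meson finite_subset image_subsetI)
  then show thesis using *(4) by (intro that[of "foldl \<delta> q0" \<delta> "\<lambda>q. q \<in> F"]) auto
qed

lemma regular_language_subset: "regular_language A L \<Longrightarrow> L \<subseteq> lists A"
  unfolding regular_language_def by blast

lemma regular_language_boolean:
  assumes "regular_language A K" "regular_language A L"
  shows "regular_language A {w \<in> lists A. Q (w \<in> K) (w \<in> L)}"
proof -
  obtain f :: "'a list \<Rightarrow> nat" and \<delta> P where f: "finite (f ` lists A)"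
    "\<And>w a. w \<in> lists A \<Longrightarrow> a \<in> A \<Longrightarrow> f (w @ [a]) = \<delta> (f w) a" "\<And>w. w \<in> K \<longleftrightarrow> w \<in> lists A \<and> P (f w)"
    using assms(1) by (rule regular_languageE) blast
  obtain g :: "'a list \<Rightarrow> nat" and \<epsilon> R where g: "finite (g ` lists A)"
    "\<And>w a. w \<in> lists A \<Longrightarrow> a \<in> A \<Longrightarrow> g (w @ [a]) = \<epsilon> (g w) a" "\<And>w. w \<in> L \<longleftrightarrow> w \<in> lists A \<and> R (g w)"
    using assms(2) by (rule regular_languageE) blast
  show ?thesis
  proof (rule regular_languageI)
    have "(\<lambda>w. (f w, g w)) ` lists A \<subseteq> f ` lists A \<times> g ` lists A" by auto
    then show "finite ((\<lambda>w. (f w, g w)) ` lists A)"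
      using f(1) g(1) by (meson finite_SigmaI finite_subset)
    show "(f (w @ [a]), g (w @ [a])) = (\<lambda>(s, t) a. (\<delta> s a, \<epsilon> t a)) (f w, g w) a"
      if "w \<in> lists A" "a \<in> A" for w a
      using that f(2) g(2) by simp
    show "{w \<in> lists A. Q (w \<in> K) (w \<in> L)} = {w \<in> lists A. (\<lambda>(s, t). Q (P s) (R t)) (f w, g w)}"
      by (rule Collect_cong) (simp only: f(3) g(3) prod.case simp_thms cong: conj_cong)
  qed
qed

lemma regular_language_Int:
  assumes "regular_language A K" "regular_language A L" shows "regular_language A (K \<inter> L)"
proof -
  have "K \<inter> L = {w \<in> lists A. w \<in> K \<and> w \<in> L}" using regular_language_subset[OF assms(1)] by blast
  then show ?thesis using regular_language_boolean[OF assms, of "(\<and>)"] by simp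
qed

lemma regular_language_Diff:
  assumes "regular_language A K" "regular_language A L" shows "regular_language A (K - L)"
proof -
  have "K - L = {w \<in> lists A. w \<in> K \<and> w \<notin> L}" using regular_language_subset[OF assms(1)] by blast
  then show ?thesis using regular_language_boolean[OF assms, of "\<lambda>p q. p \<and> \<not> q"] by simp
qed

lemma regular_language_vimage_map:
  assumes "regular_language A L" "h ` C \<subseteq> A"
  shows "regular_language C {z \<in> lists C. map h z \<in> L}"
proof -
  obtain f :: "'a list \<Rightarrow> nat" and \<delta> P where f: "finite (f ` lists A)"
    "\<And>w a. w \<in> lists A \<Longrightarrow> a \<in> A \<Longrightarrow> f (w @ [a]) = \<delta> (f w) a" "\<And>w. w \<in> L \<longleftrightarrow> w \<in> lists A \<and> P (f w)"
    using assms(1) by (rule regular_languageE) blast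
  have h: "map h z \<in> lists A" if "z \<in> lists C" for z
    using that assms(2) by (auto simp: image_subset_iff)
  show ?thesis
  proof (rule regular_languageI)
    have "(\<lambda>z. f (map h z)) ` lists C \<subseteq> f ` lists A" using h by blast
    then show "finite ((\<lambda>z. f (map h z)) ` lists C)" using f(1) finite_subset by blast
    show "f (map h (z @ [c])) = (\<lambda>s c. \<delta> s (h c)) (f (map h z)) c" if "z \<in> lists C" "c \<in> C" for z c
      using f(2)[OF h[OF that(1)], of "h c"] that assms(2) by auto
    show "{z \<in> lists C. map h z \<in> L} = {z \<in> lists C. P (f (map h z))}"
      using f(3) h by blast
  qed
qed

text \<open>The subset construction: the automaton keeps the set of states reached by the possible preimages
  of the word read so far.\<close>

lemma regular_language_image_map:
  assumes "regular_language C L" "h ` C \<subseteq> A"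
  shows "regular_language A (map h ` L)"
proof -
  obtain f :: "'a list \<Rightarrow> nat" and \<delta> P where f: "finite (f ` lists C)"
    "\<And>w a. w \<in> lists C \<Longrightarrow> a \<in> C \<Longrightarrow> f (w @ [a]) = \<delta> (f w) a" "\<And>w. w \<in> L \<longleftrightarrow> w \<in> lists C \<and> P (f w)"
    using assms(1) by (rule regular_languageE) blast
  define F where "F w = f ` {z \<in> lists C. map h z = w}" for w
  show ?thesis
  proof (rule regular_languageI)
    have "F ` lists A \<subseteq> Pow (f ` lists C)" by (auto simp: F_def)
    then show "finite (F ` lists A)" using f(1) by (meson finite_Pow_iff finite_subset)
    show "F (w @ [a]) = (\<lambda>S a. {\<delta> s c | s c. s \<in> S \<and> c \<in> C \<and> h c = a}) (F w) a"
      if "w \<in> lists A" "a \<in> A" for w a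
    proof (rule Set.set_eqI)
      fix s
      have "s \<in> F (w @ [a]) \<longleftrightarrow> (\<exists>z c. z \<in> lists C \<and> map h z = w \<and> c \<in> C \<and> h c = a \<and> s = f (z @ [c]))"
      proof
        assume "s \<in> F (w @ [a])"
        then obtain z where "z \<in> lists C" "map h z = w @ [a]" "s = f z" unfolding F_def by blast
        then show "\<exists>z c. z \<in> lists C \<and> map h z = w \<and> c \<in> C \<and> h c = a \<and> s = f (z @ [c])"
          by (cases z rule: rev_cases) auto
      next
        assume "\<exists>z c. z \<in> lists C \<and> map h z = w \<and> c \<in> C \<and> h c = a \<and> s = f (z @ [c])"
        then obtain z c where "z @ [c] \<in> lists C" "map h (z @ [c]) = w @ [a]" "s = f (z @ [c])" by auto
        then show "s \<in> F (w @ [a])" unfolding F_def by blast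
      qed
      also have "\<dots> \<longleftrightarrow> (\<exists>z c. z \<in> lists C \<and> map h z = w \<and> c \<in> C \<and> h c = a \<and> s = \<delta> (f z) c)"
        using f(2) by metis
      also have "\<dots> \<longleftrightarrow> s \<in> (\<lambda>S a. {\<delta> s c | s c. s \<in> S \<and> c \<in> C \<and> h c = a}) (F w) a"
        unfolding F_def by blast
      finally show "s \<in> F (w @ [a]) \<longleftrightarrow> s \<in> (\<lambda>S a. {\<delta> s c | s c. s \<in> S \<and> c \<in> C \<and> h c = a}) (F w) a" .
    qed
    have "map h z \<in> lists A" if "z \<in> lists C" for z
    using that assms(2) by (auto simp: image_subset_iff)
    then show "map h ` L = {w \<in> lists A. (\<lambda>S. \<exists>s\<in>S. P s) (F w)}"
      unfolding F_def using f(3) by blast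
  qed
qed

lemma regular_language_letter:
  "regular_language A {w \<in> lists A. \<exists>a\<in>set w. Q a}"
  by (rule regular_languageI[where f = "\<lambda>w. \<exists>a\<in>set w. Q a" and \<delta> = "\<lambda>b a. b \<or> Q a" and P = "\<lambda>b. b"])
    auto

text \<open>It suffices to remember the last \<open>N\<close> letters, in reverse, and whether all infixes so far were good:
  each infix is a suffix at the time when its last letter is read.\<close>

lemma regular_language_infixes:
  assumes "finite A"
  shows "regular_language A {w \<in> lists A. \<forall>x y z. w = x @ y @ z \<longrightarrow> length y \<le> N \<longrightarrow> P y}"
proof -
  define good where "good w \<longleftrightarrow> (\<forall>x y z. w = x @ y @ z \<longrightarrow> length y \<le> N \<longrightarrow> P y)" for w
  have good_snoc: "good (w @ [a]) \<longleftrightarrow> good w \<and> (\<forall>j\<le>N. P (rev (take j (rev (w @ [a])))))" for w a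
  proof (intro iffI conjI allI impI)
    assume *: "good (w @ [a])"
    show "good w"
      unfolding good_def
    proof (intro allI impI)
      fix x y z assume "w = x @ y @ z" "length y \<le> N"
      then show "P y" using *[unfolded good_def, rule_format, of x y "z @ [a]"] by simp
    qed
    fix j assume "j \<le> N"
    show "P (rev (take j (rev (w @ [a]))))"
    proof -
      have "w @ [a] = rev (drop j (rev (w @ [a]))) @ rev (take j (rev (w @ [a]))) @ []"
        by (metis append_Nil2 append_take_drop_id rev_append rev_rev_ident)
      moreover have "length (rev (take j (rev (w @ [a])))) \<le> N" using \<open>j \<le> N\<close> by simp
      ultimately show ?thesis using * unfolding good_def by blast
    qed
  next
    assume *: "good w \<and> (\<forall>j\<le>N. P (rev (take j (rev (w @ [a])))))"
    show "good (w @ [a])"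
      unfolding good_def
    proof (intro allI impI)
      fix x y z assume w: "w @ [a] = x @ y @ z" and y: "length y \<le> N"
      show "P y"
      proof (cases z rule: rev_cases)
        case Nil
        then have "rev (take (length y) (rev (w @ [a]))) = y" unfolding w by simp
        then show ?thesis using * y by metis
      next
        case (snoc z' b)
        then have "w = x @ y @ z'" using w by (simp flip: append_assoc)
        then show ?thesis using * y unfolding good_def by blast
      qed
    qed
  qed
  show ?thesis
  proof (rule regular_languageI)
    let ?f = "\<lambda>w. (take N (rev w), good w)"
    have "?f ` lists A \<subseteq> {v. set v \<subseteq> A \<and> length v \<le> N} \<times> UNIV"
      by (auto dest: in_set_takeD)
    then show "finite (?f ` lists A)"
      by (rule finite_subset) (simp add: finite_lists_length_le[OF assms])
    show "?f (w @ [a]) = (\<lambda>(v, g) a. (take N (a # v), g \<and> (\<forall>j\<le>N. P (rev (take j (a # v)))))) (?f w) a" for w a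
    proof -
      have "take j (a # take N (rev w)) = take j (a # rev w)" if "j \<le> N" for j
        using that by (cases j) (auto simp: min_def)
      then show ?thesis using good_snoc by (auto cong: conj_cong)
    qed
    show "{w \<in> lists A. \<forall>x y z. w = x @ y @ z \<longrightarrow> length y \<le> N \<longrightarrow> P y} = {w \<in> lists A. snd (?f w)}"
      by (simp add: good_def)
  qed
qed

lemma lexord_snoc_iff:
  "length u = length v \<Longrightarrow>
   (u @ [a], v @ [b]) \<in> lexord R \<longleftrightarrow> (u, v) \<in> lexord R \<or> u = v \<and> (a, b) \<in> R"
  by (induction u v rule: list_induct2) auto

lemma lexord_total_on_lists:
  "total_on A R \<Longrightarrow> u \<in> lists A \<Longrightarrow> v \<in> lists A \<Longrightarrow> (u, v) \<in> lexord R \<or> u = v \<or> (v, u) \<in> lexord R"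
proof (induction u arbitrary: v)
  case Nil
  then show ?case by (cases v) auto
next
  case (Cons a u)
  then show ?case by (cases v) (auto simp: total_on_def)
qed

lemma regular_language_lexord_pairs:
  "regular_language C {z \<in> lists C. (map snd z, map fst z) \<in> lexord R}"
proof (rule regular_languageI)
  let ?f = "\<lambda>z. ((map snd z, map fst z) \<in> lexord R, map snd z = map fst z)"
  show "finite (?f ` lists C)" by (rule finite_subset[OF subset_UNIV]) simp
  show "?f (z @ [c]) = (\<lambda>(l, e) c. (l \<or> e \<and> (snd c, fst c) \<in> R, e \<and> snd c = fst c)) (?f z) c" for z c
    by (simp add: lexord_snoc_iff)
  show "{z \<in> lists C. (map snd z, map fst z) \<in> lexord R} = {z \<in> lists C. fst (?f z)}" by simp
qed

subsection \<open>Pairs of fellow travelling words\<close>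

definition word_difference :: "('a, 'b) monoid_scheme \<Rightarrow> ('a \<times> 'a) list \<Rightarrow> 'a" where
  "word_difference G z = inv\<^bsub>G\<^esub> (word_val G (map fst z)) \<otimes>\<^bsub>G\<^esub> word_val G (map snd z)"

definition fellow_travellers ::
  "('a, 'b) monoid_scheme \<Rightarrow> 'a set \<Rightarrow> ('a \<times> 'a) set \<Rightarrow> ('a \<times> 'a) list set" where
  "fellow_travellers G D C =
     {z \<in> lists C. (\<forall>i\<le>length z. word_difference G (take i z) \<in> D) \<and> word_difference G z = \<one>\<^bsub>G\<^esub>}"

context group
begin

lemma word_difference_snoc:
  assumes "z \<in> lists (carrier G \<times> carrier G)" "a \<in> carrier G" "c \<in> carrier G"
  shows "word_difference G (z @ [(a, c)]) = inv a \<otimes> word_difference G z \<otimes> c"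
proof -
  have closed: "word_val G w \<in> carrier G" if "w \<in> lists (carrier G)" for w
    using that by (induction w) (auto simp: word_val_def)
  have snoc: "word_val G (w @ [b]) = word_val G w \<otimes> b" if "w \<in> lists (carrier G)" "b \<in> carrier G" for w b
    using that by (induction w) (use closed in \<open>auto simp: word_val_def m_assoc\<close>)
  have "map fst z \<in> lists (carrier G)" "map snd z \<in> lists (carrier G)"
    using assms(1) by (auto simp: mem_Times_iff)
  then show ?thesis
    using assms closed by (simp add: word_difference_def snoc inv_mult_group m_assoc)
qed

text \<open>The difference \<open>inv u \<otimes> v\<close> of the prefixes is updated letter by letter, and only finitely many
  values are allowed.\<close>

lemma regular_language_fellow_travellers:
  assumes C: "C \<subseteq> carrier G \<times> carrier G" and D: "finite D"
  shows "regular_language C (fellow_travellers G D C)"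
proof (rule regular_languageI)
  let ?close = "\<lambda>z. \<forall>i\<le>length z. word_difference G (take i z) \<in> D"
  let ?f = "\<lambda>z. if ?close z then Some (word_difference G z) else None"
  let ?\<delta> = "\<lambda>s (a, c). case s of None \<Rightarrow> None | Some h \<Rightarrow>
      (if inv a \<otimes> h \<otimes> c \<in> D then Some (inv a \<otimes> h \<otimes> c) else None)"
  have "?f z \<in> insert None (Some ` D)" for z
    using spec[of _ "length z"] by fastforce
  then have "?f ` lists C \<subseteq> insert None (Some ` D)" by (rule image_subsetI)
  then show "finite (?f ` lists C)" using D by (meson finite.insertI finite_imageI finite_subset)
  show "?f (z @ [p]) = ?\<delta> (?f z) p" if z: "z \<in> lists C" and p: "p \<in> C" for z p
  proof -
    obtain a c where ac: "p = (a, c)" "a \<in> carrier G" "c \<in> carrier G" using p C by blast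
    have "z \<in> lists (carrier G \<times> carrier G)" using z C lists_mono by blast
    then have d: "word_difference G (z @ [p]) = inv a \<otimes> word_difference G z \<otimes> c"
      using word_difference_snoc ac by simp
    have "?close (z @ [p]) \<longleftrightarrow> ?close z \<and> word_difference G (z @ [p]) \<in> D"
      by (auto simp: le_Suc_eq)
    then show ?thesis using d ac by simp
  qed
  show "fellow_travellers G D C = {z \<in> lists C. ?f z = Some \<one>}"
    by (auto simp: fellow_travellers_def)
qed

end

section \<open>The regular language of local Morse geodesics\<close>

context cayley_group
begin

text \<open>Words whose path leaves the identity at almost unit speed are followed synchronously by every
  geodesic word with the same end. By the Morse property, the vertex of \<open>v\<close> at time \<open>i\<close> is near some
  point of the path of \<open>w\<close>; distances from the identity show that the time of that point is nearly
  \<open>i\<close>. The slack \<open>2\<close> covers a geodesic word extended by a single letter.\<close>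

lemma geodesic_fellow_travels:
  fixes M :: "real \<Rightarrow> real \<Rightarrow> real"
  assumes w: "w \<in> lists A" and speed: "\<And>i. i \<le> length w \<Longrightarrow> i \<le> len (val (take i w)) + 2"
    and morse: "morse X M {0..real (length w)} (word_path G w)" and M: "M 1 0 \<ge> 0"
    and v: "geodesic_word G A v" and same_end: "val v = val w" and i: "i \<le> length w"
  shows "real (len (inv (val (take i w)) \<otimes> val (take i v))) \<le> 2 * M 1 0 + 4"
proof -
  let ?\<gamma> = "word_path G w" and ?\<eta> = "word_path G v"
  have vA: "v \<in> lists A" and lenv: "len (val v) = length v" using v geodesic_word_iff by auto
  have m: "length v \<le> length w" "length w \<le> length v + 2"
    using len_val_le[OF w] speed[of "length w"] lenv same_end by auto
  have \<gamma>_points: "?\<gamma> x \<in> points" if "x \<in> {0..real (length w)}" for x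
    using word_path_in_points[OF w that] .
  have \<gamma>0: "?\<gamma> 0 = vertex \<one>" "?\<eta> 0 = vertex \<one>"
    using word_path_at_nat[of G w 0] word_path_at_nat[of G v 0] by auto
  have \<gamma>j: "?\<gamma> (real j) = vertex (val (take j w))" "?\<eta> (real j) = vertex (val (take j v))" for j
    by (rule word_path_at_nat)+
  have goal_dist: "len (inv (val (take i w)) \<otimes> val (take i v)) = dist_X (?\<eta> i) (?\<gamma> i)"
    using dist_vertex[of "val (take i w)" "val (take i v)"] w vA by (simp add: \<gamma>j mdist_commute)
  show ?thesis
  proof (cases "i \<le> length v")
    case True
    have "quasi_geodesic X 1 0 {0..real (length v)} ?\<eta>"
      using v unfolding geodesic_word_def geodesic_def by blast
    moreover have "?\<eta> 0 = ?\<gamma> 0" "?\<eta> (length v) = ?\<gamma> (length w)"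
      using \<gamma>0 \<gamma>j same_end by auto
    moreover have "real i \<in> {0..real (length v)}" using True by simp
    ultimately obtain y where y: "y \<in> {0..real (length w)}" "dist_X (?\<eta> i) (?\<gamma> y) \<le> M 1 0"
      using morse[unfolded morse_def, rule_format, of 0 "real (length w)" 1 0 0 "real (length v)" ?\<eta> "real i"]
      by auto
    define j where "j = nat \<lfloor>y\<rfloor>"
    have j: "real j \<le> y" "y < real j + 1" "j \<le> length w"
      using y(1) by (auto simp: j_def le_floor_iff nat_le_iff floor_le_iff)
    have "real j \<le> dist_X (vertex \<one>) (?\<gamma> j) + 2"
      using speed[OF j(3)] w by (simp add: \<gamma>j dist_vertex_one)
    moreover have "dist_X (vertex \<one>) (?\<gamma> j) \<le> dist_X (vertex \<one>) (?\<gamma> y) + dist_X (?\<gamma> y) (?\<gamma> j)"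
      by (rule mdist_triangle) (use \<gamma>_points y j in auto)
    moreover have "dist_X (?\<gamma> y) (?\<gamma> j) \<le> y - j"
      using word_path_lipschitz[OF w y(1), of j] j by auto
    (* One unit is lost in rounding y down, one in moving back from j to y, two in the speed of w. *)
    ultimately have lower: "y - 4 \<le> dist_X (vertex \<one>) (?\<gamma> y)" using j by linarith
    have upper: "dist_X (vertex \<one>) (?\<gamma> y) \<le> y"
      using word_path_lipschitz[OF w, of 0 y] y(1) by (simp add: \<gamma>0)
    have start: "dist_X (vertex \<one>) (?\<eta> i) = i"
      using geodesic_word_dist[OF v, of 0 i] True by (simp add: \<gamma>0)
    have \<eta>i: "?\<eta> i \<in> points" using word_path_in_points[OF vA] True by simp
    have "dist_X (vertex \<one>) (?\<eta> i) \<le> dist_X (vertex \<one>) (?\<gamma> y) + dist_X (?\<gamma> y) (?\<eta> i)"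
      "dist_X (vertex \<one>) (?\<gamma> y) \<le> dist_X (vertex \<one>) (?\<eta> i) + dist_X (?\<eta> i) (?\<gamma> y)"
      by (rule mdist_triangle; use \<gamma>_points y \<eta>i in auto)+
    then have "\<bar>y - i\<bar> \<le> M 1 0 + 4"
      using lower upper start y(2) by (simp add: mdist_commute)
    moreover have "dist_X (?\<gamma> y) (?\<gamma> i) \<le> \<bar>y - i\<bar>"
      using word_path_lipschitz[OF w y(1), of i] i by auto
    moreover have "dist_X (?\<eta> i) (?\<gamma> i) \<le> dist_X (?\<eta> i) (?\<gamma> y) + dist_X (?\<gamma> y) (?\<gamma> i)"
      by (rule mdist_triangle) (use \<gamma>_points y \<eta>i i in auto)
    ultimately show ?thesis using goal_dist y(2) by linarith
  next
    case False
    then have "?\<eta> i = ?\<gamma> (length w)" using same_end by (simp add: \<gamma>j)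
    moreover have "dist_X (?\<gamma> (length w)) (?\<gamma> i) \<le> real (length w) - i"
      using word_path_lipschitz[OF w, of "length w" i] i by auto
    moreover have "real (length w) \<le> real i + 2" using m False by linarith
    ultimately have "dist_X (?\<eta> i) (?\<gamma> i) \<le> 2" by simp
    then show ?thesis using goal_dist M by linarith
  qed
qed

lemma zip_lists: "u \<in> lists B \<Longrightarrow> v \<in> lists C \<Longrightarrow> zip u v \<in> lists (B \<times> C)"
  by (auto dest: set_zip_leftD set_zip_rightD)

lemma shortest_nongeodesic_prefix:
  assumes "w \<in> lists A" "\<not> geodesic_word G A w"
  obtains p a r where "w = p @ [a] @ r" "geodesic_word G A p" "\<not> geodesic_word G A (p @ [a])"
proof -
  have "\<exists>p a r. w = p @ [a] @ r \<and> geodesic_word G A p \<and> \<not> geodesic_word G A (p @ [a])"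
    using assms
  proof (induction w rule: rev_induct)
    case Nil
    then show ?case by (simp add: geodesic_word_iff)
  next
    case (snoc a w)
    show ?case
    proof (cases "geodesic_word G A w")
      case True
      then show ?thesis using snoc.prems by (intro exI[of _ w] exI[of _ a] exI[of _ "[]"]) simp
    next
      case False
      then obtain p b r where "w = p @ [b] @ r" "geodesic_word G A p" "\<not> geodesic_word G A (p @ [b])"
        using snoc by auto
      then show ?thesis by (intro exI[of _ p] exI[of _ b] exI[of _ "r @ [a]"]) simp
    qed
  qed
  then show ?thesis using that by blast
qed

lemma val_snoc_ones:
  assumes "v \<in> lists (carrier G)" shows "val (v @ replicate n \<one>) = val v"
proof -
  have "val (replicate n \<one>) = \<one>" by (induction n) auto
  moreover have "replicate n \<one> \<in> lists (carrier G)" by (induction n) auto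
  ultimately show ?thesis using assms val_append[OF assms, of "replicate n \<one>"] by simp
qed

lemma len_less_if_one_occurs:
  assumes "u \<in> lists (insert \<one> A)" "\<one> \<in> set u" shows "len (val u) < length u"
proof -
  have closed: "val u \<in> carrier G" if "u \<in> lists (insert \<one> A)" for u
    using that A_carrier by (intro val_closed) auto
  have "val (filter (\<lambda>a. a \<noteq> \<one>) u) = val u"
    using assms(1) by (induction u) (use closed in auto)
  moreover have "filter (\<lambda>a. a \<noteq> \<one>) u \<in> lists A" using assms(1) by auto
  moreover have "length (filter (\<lambda>a. a \<noteq> \<one>) u) < length u"
    using assms(2) by (intro length_filter_less) auto
  ultimately show ?thesis using len_val_le by fastforce
qed

abbreviation len_ball :: "real \<Rightarrow> 'a set" where
  "len_ball K \<equiv> {g \<in> carrier G. real (len g) \<le> K}"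

text \<open>Words accompanied, at bounded distance, by a companion with the same end that stands still at
  least once. Standing still is spelled by the letter \<open>\<one>\<close>: if \<open>\<one>\<close> happens to be a generator, the
  edge is a loop, and so reading it is standing still as well.\<close>

definition detours :: "real \<Rightarrow> 'a list set" where
  "detours K = map fst ` (fellow_travellers G (len_ball K) (A \<times> insert \<one> A) \<inter>
     {z \<in> lists (A \<times> insert \<one> A). \<exists>p\<in>set z. snd p = \<one>})"

lemma regular_detours: "regular_language A (detours K)"
  unfolding detours_def
proof (rule regular_language_image_map[OF regular_language_Int])
  show "regular_language (A \<times> insert \<one> A) (fellow_travellers G (len_ball K) (A \<times> insert \<one> A))"
    using A_carrier finite_len_ball by (intro regular_language_fellow_travellers) auto
qed (auto intro: regular_language_letter)

lemma word_difference_eq_one: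
  assumes "word_difference G z = \<one>" "z \<in> lists (carrier G \<times> carrier G)"
  shows "val (map fst z) = val (map snd z)"
proof -
  have "map fst z \<in> lists (carrier G)" "map snd z \<in> lists (carrier G)"
    using assms(2) by (auto simp: mem_Times_iff)
  then show ?thesis
    using assms(1) unfolding word_difference_def
    by (metis inv_closed inv_equality inv_inv val_closed)
qed

text \<open>Deleting the pauses of the companion leaves a shorter word with the same end.\<close>

lemma detour_not_geodesic: "w \<in> detours K \<Longrightarrow> \<not> geodesic_word G A w"
proof
  assume "w \<in> detours K" "geodesic_word G A w"
  then obtain z where z: "w = map fst z" "z \<in> lists (A \<times> insert \<one> A)" "word_difference G z = \<one>"
    "\<exists>p\<in>set z. snd p = \<one>" and w: "len (val w) = length w"
    unfolding detours_def fellow_travellers_def geodesic_word_iff by blast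
  have "\<one> \<in> set (map snd z)" using z(4) by force
  have "z \<in> lists (carrier G \<times> carrier G)" using z(2) A_carrier by auto
  then have "val w = val (map snd z)" using word_difference_eq_one z by simp
  moreover have "map snd z \<in> lists (insert \<one> A)" using z(2) by (auto simp: mem_Times_iff)
  ultimately show False using len_less_if_one_occurs[of "map snd z"] \<open>\<one> \<in> set (map snd z)\<close> z(1) w by simp
qed

text \<open>At the first moment when \<open>w\<close> stops being geodesic, its prefix is a geodesic plus one letter. A
  geodesic to the same vertex is shorter and fellow travels; made to wait at its end and then to copy
  the rest of \<open>w\<close>, it is a companion that stands still.\<close>

lemma detour_if_not_geodesic:
  assumes w: "w \<in> lists A" "\<not> geodesic_word G A w" and M: "M 1 0 \<ge> 0"
    and morse: "\<And>u r. w = u @ r \<Longrightarrow> morse X M {0..real (length u)} (word_path G u)"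
  shows "w \<in> detours (2 * M 1 0 + 4)"
proof -
  obtain p a r where par: "w = p @ [a] @ r" and p: "geodesic_word G A p"
    and pa: "\<not> geodesic_word G A (p @ [a])"
    using shortest_nongeodesic_prefix[OF w] .
  let ?K = "2 * M 1 0 + 4" and ?w = "p @ [a]"
  have A: "?w \<in> lists A" "p \<in> lists A" "a \<in> A" "r \<in> lists A" using w(1) par by auto
  note C = lists_A_carrier[OF A(1)] lists_A_carrier[OF A(4)]
  obtain v where v: "v \<in> lists A" "length v = len (val ?w)" "val v = val ?w"
    using shortest_word[of "val ?w"] C by blast
  have geo_v: "geodesic_word G A v" using v by (simp add: geodesic_word_iff)
  have shorter: "length v < length ?w"
    using pa len_val_le[OF A(1)] A(1) v(2) unfolding geodesic_word_iff by simp
  have speed: "i \<le> len (val (take i ?w)) + 2" if i: "i \<le> length ?w" for i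
  proof (cases "i \<le> length p")
    case True
    then have "geodesic_word G A (take i p)"
      using geodesic_word_infix[of "[]" "take i p" "drop i p"] p by simp
    then show ?thesis using True by (simp add: geodesic_word_iff)
  next
    case False
    have a: "a \<in> carrier G" using A(3) A_carrier by blast
    have "val p = val ?w \<otimes> inv a"
      using a lists_A_carrier[OF A(2)] val_append[of p "[a]"] val_closed[of p] by (simp add: m_assoc)
    then have "len (val p) \<le> len (val ?w) + len (inv a)"
      using len_mult_le[OF val_closed[OF C(1)] inv_closed[OF a]] by simp
    then have "len (val p) \<le> len (val ?w) + 1"
      using len_generator[OF A_inv[OF A(3)]] by linarith
    moreover have "len (val p) = length p" using p by (simp add: geodesic_word_iff)
    moreover have "take i ?w = ?w" "i = Suc (length p)" using False i by auto
    ultimately show ?thesis by simp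
  qed
  define v' where "v' = v @ replicate (length ?w - length v) \<one>"
  have lv': "length v' = length ?w" using shorter by (simp add: v'_def)
  have v': "v' \<in> lists (insert \<one> A)" "v' \<in> lists (carrier G)" "val v' = val ?w"
    using v lists_A_carrier[OF v(1)] val_snoc_ones[of v] by (auto simp: v'_def)
  have v'_take: "val (take i v') = val (take i v)" for i
    using val_snoc_ones[OF take_lists[OF lists_A_carrier[OF v(1)]], of i]
    by (simp add: v'_def take_replicate)
  define z where "z = zip w (v' @ r)"
  have z: "map fst z = w" "map snd z = v' @ r" "length z = length w"
    using par lv' by (simp_all add: z_def)
  have zC: "z \<in> lists (A \<times> insert \<one> A)"
    unfolding z_def by (rule zip_lists) (use w(1) v'(1) A(4) in auto)
  have close: "word_difference G (take i z) \<in> len_ball ?K" if "i \<le> length z" for i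
  proof (cases "i \<le> length ?w")
    case True
    have "take i w = take i ?w" "take i (v' @ r) = take i v'" using True par lv' by (auto simp: take_Cons')
    then have "word_difference G (take i z) = inv (val (take i ?w)) \<otimes> val (take i v)"
      unfolding word_difference_def take_map[symmetric] z by (simp only: v'_take)
    moreover have "len (inv (val (take i ?w)) \<otimes> val (take i v)) \<le> ?K"
      using morse[of ?w r] par
      by (intro geodesic_fellow_travels[where M = M, OF A(1) speed _ M geo_v v(3) True]) auto
    ultimately show ?thesis
      using val_take_closed[OF A(1)] val_take_closed[OF v(1)] by simp
  next
    case False
    then have "take i w = ?w @ take (i - length ?w) r" "take i (v' @ r) = v' @ take (i - length ?w) r"
      using par lv' by (auto simp: take_Cons')
    then have "word_difference G (take i z) = \<one>"
      using v' C val_append[OF C(1) take_lists[OF C(2)]] val_append[OF v'(2) take_lists[OF C(2)]]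
        val_closed[OF C(1)] val_closed[OF take_lists[OF C(2)]]
      unfolding word_difference_def take_map[symmetric] z by simp
    then show ?thesis using M by simp
  qed
  moreover have "word_difference G z = \<one>"
    using par v' C val_append[OF C] val_append[OF v'(2) C(2)] val_closed[OF C(1)] val_closed[OF C(2)]
    unfolding word_difference_def z by simp
  moreover have "\<exists>p\<in>set z. snd p = \<one>"
  proof -
    have "\<one> \<in> set (map snd z)" unfolding z v'_def using shorter by simp
    then show ?thesis by force
  qed
  ultimately show ?thesis
    using zC z(1) unfolding detours_def fellow_travellers_def by (intro image_eqI[of _ _ z]) auto
qed

definition locally_morse_words :: "nat \<Rightarrow> (real \<Rightarrow> real \<Rightarrow> real) \<Rightarrow> 'a list set" where
  "locally_morse_words N M =
     {w \<in> lists A. \<forall>x y z. w = x @ y @ z \<longrightarrow> length y \<le> N \<longrightarrow> morse_geodesic_word G A M y}"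

lemma locally_morse_words_prefix:
  assumes "u @ r \<in> locally_morse_words N M" shows "u \<in> locally_morse_words N M"
  unfolding locally_morse_words_def
proof (intro CollectI conjI allI impI)
  show "u \<in> lists A" using assms by (simp add: locally_morse_words_def)
  fix x y z assume "u = x @ y @ z" "length y \<le> N"
  then have "u @ r = x @ y @ (z @ r)" "length y \<le> N" by auto
  then show "morse_geodesic_word G A M y" using assms unfolding locally_morse_words_def by blast
qed

lemma regular_geodesic_locally_morse_words:
  assumes M': "morse_gauge M'"
    and global: "\<And>w. w \<in> locally_morse_words N M \<Longrightarrow> morse X M' {0..real (length w)} (word_path G w)"
  shows "regular_language A {w \<in> locally_morse_words N M. geodesic_word G A w}"
proof -
  have 0: "M' 1 0 \<ge> 0" using M' unfolding morse_gauge_def by simp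
  have "w \<in> detours (2 * M' 1 0 + 4)" if "w \<in> locally_morse_words N M" "\<not> geodesic_word G A w" for w
  proof (rule detour_if_not_geodesic[where M = M', OF _ that(2) 0])
    show "w \<in> lists A" using that(1) unfolding locally_morse_words_def by blast
    show "morse X M' {0..real (length u)} (word_path G u)" if "w = u @ r" for u r
      using global locally_morse_words_prefix \<open>w \<in> locally_morse_words N M\<close> that by blast
  qed
  then have "{w \<in> locally_morse_words N M. geodesic_word G A w}
      = locally_morse_words N M - detours (2 * M' 1 0 + 4)"
    using detour_not_geodesic by blast
  moreover have "regular_language A (locally_morse_words N M)"
    unfolding locally_morse_words_def by (rule regular_language_infixes[OF finite_A])
  ultimately show ?thesis by (simp only: regular_detours regular_language_Diff)
qed

text \<open>Two Morse geodesic words with the same end have equal length and fellow travel, so a word fails to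
  be least exactly if an automaton finds a lexicographically smaller fellow traveller in the language.\<close>

lemma regular_short_lex:
  assumes L: "regular_language A L" and morse: "\<And>w. w \<in> L \<Longrightarrow> morse_geodesic_word G A M w"
    and M: "M 1 0 \<ge> 0" and r: "linear_order_on A r"
  shows "regular_language A (short_lex G r L)"
proof -
  let ?K = "2 * M 1 0 + 4" and ?C = "A \<times> A"
  let ?R = "lexord (r - Id)"
  let ?Z = "fellow_travellers G (len_ball ?K) ?C \<inter>
      ({z \<in> lists ?C. map snd z \<in> L} \<inter> {z \<in> lists ?C. (map snd z, map fst z) \<in> ?R})"
  have "asym (r - Id)"
    using r unfolding linear_order_on_def partial_order_on_def antisym_def asym_on_def by blast
  then have asym: "(v, u) \<notin> ?R" if "(u, v) \<in> ?R" for u v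
    using lexord_asymmetric that by blast
  have total: "(u, v) \<in> ?R \<or> u = v \<or> (v, u) \<in> ?R" if "u \<in> lists A" "v \<in> lists A" for u v
    using lexord_total_on_lists[of A "r - Id"] r that unfolding linear_order_on_def total_on_def by auto
  have LA: "w \<in> lists A" and Lgeo: "geodesic_word G A w" if "w \<in> L" for w
    using morse[OF that] unfolding morse_geodesic_word_def geodesic_word_def by auto
  have lenL: "len (val w) = length w" if "w \<in> L" for w using Lgeo[OF that] geodesic_word_iff by blast
  have "short_lex G r L = L - map fst ` ?Z"
  proof (intro equalityI subsetI)
    fix u assume u: "u \<in> short_lex G r L"
    have "u \<notin> map fst ` ?Z"
    proof
      assume "u \<in> map fst ` ?Z"
      then obtain z where z: "u = map fst z" "z \<in> lists ?C" "word_difference G z = \<one>" "map snd z \<in> L"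
        "(map snd z, u) \<in> ?R"
        unfolding fellow_travellers_def by blast
      have "z \<in> lists (carrier G \<times> carrier G)" using z(2) A_carrier by auto
      then have "val (map snd z) = val u" using word_difference_eq_one z(1,3) by simp
      then have "lex_le r u (map snd z)" using u z(4) unfolding short_lex_def by blast
      then show False using asym[OF z(5)] z(5) unfolding lex_le_def by auto
    qed
    then show "u \<in> L - map fst ` ?Z" using u unfolding short_lex_def by blast
  next
    fix u assume u: "u \<in> L - map fst ` ?Z"
    have "lex_le r u v" if v: "v \<in> L" "val v = val u" for v
    proof (rule ccontr)
      assume "\<not> lex_le r u v"
      then have less: "(v, u) \<in> ?R" using total LA u v(1) unfolding lex_le_def by blast
      have same_length: "length v = length u" using lenL[OF v(1)] lenL[of u] v(2) u by simp
      define z where "z = zip u v"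
      have z: "map fst z = u" "map snd z = v" "length z = length u"
        using same_length by (simp_all add: z_def)
      have uA: "u \<in> lists A" and vA: "v \<in> lists A" using LA u v by auto
      have zC: "z \<in> lists ?C" unfolding z_def by (rule zip_lists[OF uA vA])
      have "word_difference G (take i z) \<in> len_ball ?K" if i: "i \<le> length z" for i
      proof -
        have "len (inv (val (take i u)) \<otimes> val (take i v)) \<le> ?K"
        proof (rule geodesic_fellow_travels[where M = M, OF uA _ _ M Lgeo[OF v(1)] v(2)])
          show "morse X M {0..real (length u)} (word_path G u)"
            using morse u unfolding morse_geodesic_word_def by blast
          show "j \<le> len (val (take j u)) + 2" if "j \<le> length u" for j
          proof -
            have "geodesic_word G A (take j u)"
              using geodesic_word_infix[of "[]" "take j u" "drop j u"] Lgeo u by simp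
            then show ?thesis using that by (simp add: geodesic_word_iff)
          qed
        qed (use i z in simp)
        then show ?thesis
          using val_take_closed[OF uA] val_take_closed[OF vA]
          unfolding word_difference_def take_map[symmetric] z by simp
      qed
      moreover have "word_difference G z = \<one>"
        using v(2) val_closed[OF lists_A_carrier[OF uA]] unfolding word_difference_def z by simp
      ultimately have "z \<in> ?Z" using zC z less v(1) unfolding fellow_travellers_def by simp
      then show False using u z(1) by blast
    qed
    then show "u \<in> short_lex G r L" using u unfolding short_lex_def by blast
  qed
  moreover have "regular_language A (map fst ` ?Z)"
  proof (rule regular_language_image_map[OF regular_language_Int[OF _ regular_language_Int]])
    show "regular_language ?C (fellow_travellers G (len_ball ?K) ?C)"
      using A_carrier finite_len_ball by (intro regular_language_fellow_travellers) auto
    show "regular_language ?C {z \<in> lists ?C. map snd z \<in> L}"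
      by (rule regular_language_vimage_map[OF L]) auto
  qed (auto intro: regular_language_lexord_pairs)
  ultimately show ?thesis using L regular_language_Diff by simp
qed

text \<open>The geodesic words among those with \<open>M\<close>-Morse infixes of bounded length form the required
  language: the bound on the infixes is a local condition, so the local-to-global property makes the
  whole paths Morse with a gauge that depends on \<open>M\<close> alone.\<close>

theorem morse_geodesic_words_regular:
  assumes mltg: "morse_local_to_global_space X" and M: "morse_gauge M"
  shows "\<exists>M'. morse_gauge M' \<and>
    (\<exists>L. regular_language A L \<and> (\<forall>w. morse_geodesic_word G A M w \<longrightarrow> w \<in> L) \<and>
         (\<forall>w\<in>L. morse_geodesic_word G A M' w) \<and>
         (\<forall>r. linear_order_on A r \<longrightarrow> regular_language A (short_lex G r L)))"
proof -
  obtain B M' k' c' where M': "morse_gauge M'"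
    and global: "\<And>I \<gamma>. local_morse_quasi_geodesic X B M 1 0 I \<gamma> \<Longrightarrow> morse_quasi_geodesic X M' k' c' I \<gamma>"
    using mltg[unfolded morse_local_to_global_space_def, rule_format, of M 1 0] M by auto
  let ?L = "locally_morse_words (nat \<lceil>B\<rceil> + 1) M"
  have morse: "morse X M' {0..real (length w)} (word_path G w)" if "w \<in> ?L" for w
    using global[OF local_morse_word_path, of w] that
    unfolding locally_morse_words_def morse_quasi_geodesic_def by blast
  let ?G = "{w \<in> ?L. geodesic_word G A w}"
  have regular: "regular_language A ?G"
    by (rule regular_geodesic_locally_morse_words[OF M' morse])
  moreover have "w \<in> ?G" if "morse_geodesic_word G A M w" for w
  proof -
    have "geodesic_word G A w" using that unfolding morse_geodesic_word_def by blast
    moreover from this have "w \<in> lists A" unfolding geodesic_word_iff by blast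
    ultimately show ?thesis using that morse_geodesic_word_infix unfolding locally_morse_words_def by blast
  qed
  moreover have sound: "morse_geodesic_word G A M' w" if "w \<in> ?G" for w
    using that morse unfolding morse_geodesic_word_def by blast
  moreover have "regular_language A (short_lex G r ?G)" if "linear_order_on A r" for r
    using regular_short_lex[OF regular sound _ that] M' unfolding morse_gauge_def by simp
  ultimately show ?thesis using M' by (intro exI[of _ M'] exI[of _ ?G] conjI) blast+
qed

end

theorem theorem4:
  fixes G :: "('a, 'b) monoid_scheme" and A :: "'a set"
  assumes "group G"
    and "morse_local_to_global_group G"
    and "finite_symmetric_generating_set G A"
  shows "\<exists>\<Phi> :: (real \<Rightarrow> real \<Rightarrow> real) \<Rightarrow> (real \<Rightarrow> real \<Rightarrow> real).
    \<forall>M. morse_gauge M \<longrightarrow>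
      morse_gauge (\<Phi> M) \<and>
      (\<exists>L. regular_language A L \<and>
           (\<forall>w. morse_geodesic_word G A M w \<longrightarrow> w \<in> L) \<and>
           (\<forall>w\<in>L. morse_geodesic_word G A (\<Phi> M) w) \<and>
           (\<forall>r. linear_order_on A r \<longrightarrow> regular_language A (short_lex G r L)))"
proof -
  interpret cayley_group G A
    using assms(1,3) by (simp add: cayley_group_def cayley_group_axioms_def)
  show ?thesis
  proof (intro choice allI)
    fix M :: "real \<Rightarrow> real \<Rightarrow> real"
    show "\<exists>M'. morse_gauge M \<longrightarrow> morse_gauge M' \<and>
      (\<exists>L. regular_language A L \<and>
           (\<forall>w. morse_geodesic_word G A M w \<longrightarrow> w \<in> L) \<and>
           (\<forall>w\<in>L. morse_geodesic_word G A M' w) \<and>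
           (\<forall>r. linear_order_on A r \<longrightarrow> regular_language A (short_lex G r L)))"
    proof (cases "morse_gauge M")
      case True
      from morse_geodesic_words_regular[OF morse_local_to_global_Cayley_graph[OF assms(2)] this]
      show ?thesis by (rule ex_forward) (rule impI)
    qed simp
  qed
qed

end
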